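(* For every constant $C_0>0$ there is a constant $C=C(C_0)>0$ such that the following holds. Let $n\ge 1$, let $\mathcal A$ be a finite-dimensional $C^*$-algebra with $\dim_{\mathbb C}\mathcal A\le C_0 n$, and let $A_1,\dots,A_n\in\mathcal A$ satisfy $\|A_i\|\le 1$ for all $i$. Then there exists $x\in\{\pm1\}^n$ such that $$\Bigl\|\sum_{i=1}^n x_iA_i\Bigr\|\le C\sqrt n .$$
   Context: A finite-dimensional $C^*$-algebra is viewed as a $*$-subalgebra of the bounded operators on a finite-dimensional complex Hilbert space, and $\|\cdot\|$ denotes the operator norm ($C^*$-norm). The elements $A_i$ are not assumed self-adjoint. The dimension of the Hilbert space is arbitrary; the $O(\cdot)$ notation has been expanded: $\dim_{\mathbb C}\mathcal A\le O(n)$ means $\dim_{\mathbb C}\mathcal A\le C_0n$, and the final constant depends only on $C_0$. *)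

theory Defs
  imports "Jordan_Normal_Form.Schur_Decomposition" "HOL-Analysis.L2_Norm"
begin

text \<open>
  A complex Hilbert space of dimension \<open>d\<close> is represented, after choosing an orthonormal basis,
  by column vectors of dimension \<open>d\<close> with the standard inner product, and the bounded operators
  on it by the \<open>d \<times> d\<close> complex matrices. Matrices with an explicit dimension are used (rather
  than a type-indexed dimension) so that \<open>d\<close> can be quantified inside a formula.
\<close>

abbreviation op_space :: "nat \<Rightarrow> (complex, complex mat) module" where
  "op_space d \<equiv> module_mat TYPE(complex) d d"

definition hnorm :: "complex vec \<Rightarrow> real" where
  "hnorm v = sqrt (Re (v \<bullet>c v))"

definition op_norm :: "complex mat \<Rightarrow> real" where
  "op_norm a = (SUP v \<in> {v \<in> carrier_vec (dim_col a). hnorm v \<le> 1}. hnorm (a *\<^sub>v v))"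

text \<open>
  Every *-subalgebra of the \<open>d \<times> d\<close> matrices is closed, so no topological condition is needed.
  The algebra is not required to contain the identity matrix: its unit may be a proper projection.
\<close>

definition star_subalgebra :: "nat \<Rightarrow> complex mat set \<Rightarrow> bool" where
  "star_subalgebra d \<A> \<longleftrightarrow>
     VectorSpace.subspace class_ring \<A> (op_space d) \<and>
     (\<forall>a\<in>\<A>. \<forall>b\<in>\<A>. a * b \<in> \<A>) \<and>
     (\<forall>a\<in>\<A>. mat_adjoint a \<in> \<A>)"

definition complex_dim :: "nat \<Rightarrow> complex mat set \<Rightarrow> nat" where
  "complex_dim d \<A> = vectorspace.dim class_ring ((op_space d)\<lparr>carrier := \<A>\<rparr>)"

lemma hnorm_L2_set: "hnorm v = L2_set (\<lambda>i. cmod (v $ i)) {..<dim_vec v}"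
proof -
  have "v \<bullet>c v = (\<Sum>i<dim_vec v. complex_of_real ((cmod (v $ i))\<^sup>2))"
    unfolding scalar_prod_def dim_vec_conjugate lessThan_atLeast0
    by (rule sum.cong) (auto simp del: of_real_power simp: complex_norm_square)
  then show ?thesis
    by (simp add: hnorm_def L2_set_def flip: of_real_sum)
qed

text \<open>The supremum in \<open>op_norm\<close> is over a nonempty set that is bounded above.\<close>

lemma op_norm_bdd_above:
  "bdd_above ((\<lambda>v. hnorm (a *\<^sub>v v)) ` {v \<in> carrier_vec (dim_col a). hnorm v \<le> 1})"
proof (rule bdd_aboveI2)
  fix v assume v: "v \<in> {v \<in> carrier_vec (dim_col a). hnorm v \<le> 1}"
  have ent: "cmod (v $ j) \<le> 1" if "j < dim_col a" for j
    using member_le_L2_set[of "{..<dim_vec v}" j "\<lambda>i. cmod (v $ i)"] v that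
    by (auto simp: hnorm_L2_set)
  have row: "cmod ((a *\<^sub>v v) $ i) \<le> (\<Sum>j<dim_col a. cmod (a $$ (i,j)))"
    if i: "i < dim_row a" for i
  proof -
    have "(a *\<^sub>v v) $ i = (\<Sum>j<dim_col a. a $$ (i,j) * v $ j)"
      using v i by (auto simp: scalar_prod_def lessThan_atLeast0)
    also have "cmod \<dots> \<le> (\<Sum>j<dim_col a. cmod (a $$ (i,j)))"
    proof (rule sum_norm_le)
      fix j assume "j \<in> {..<dim_col a}"
      then show "cmod (a $$ (i,j) * v $ j) \<le> cmod (a $$ (i,j))"
        using ent[of j] by (auto simp: norm_mult intro: mult_left_le)
    qed
    finally show ?thesis .
  qed
  have "hnorm (a *\<^sub>v v) \<le> (\<Sum>i<dim_row a. cmod ((a *\<^sub>v v) $ i))"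
    unfolding hnorm_L2_set
    using L2_set_le_sum[of "{..<dim_row a}" "\<lambda>i. cmod ((a *\<^sub>v v) $ i)"] by simp
  also have "\<dots> \<le> (\<Sum>i<dim_row a. \<Sum>j<dim_col a. cmod (a $$ (i,j)))"
    by (rule sum_mono) (use row in auto)
  finally show "hnorm (a *\<^sub>v v) \<le> (\<Sum>i<dim_row a. \<Sum>j<dim_col a. cmod (a $$ (i,j)))" .
qed

end

theory Submission
  imports Defs "HOL-Analysis.Function_Topology" "HOL-Analysis.Convex"
begin

text \<open>
  Let \<open>\<A>\<close> act on itself by left multiplication. With the real part of the trace inner product,
  \<open>\<A>\<close> is a real Euclidean space of dimension \<open>N \<le> 2 C\<^sub>0 n\<close>, left multiplication by \<open>A\<^sub>l\<close> is a
  contraction \<open>T\<^sub>l\<close> of it, and a *-algebra is represented isometrically in this way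
  (\<open>bound_extends_from_algebra\<close>). So it suffices to find signs for which
  \<open>T\<^sub>x = \<Sum> x\<^sub>l T\<^sub>l\<close> has norm \<open>O((N n)\<^sup>1\<^sup>/\<^sup>4)\<close>. The gain over an arbitrary family of \<open>N \<times> N\<close> contractions is
  that singular values are cheap to control: the vectors on which \<open>T\<^sub>x\<close> attains its norm \<open>C\<close> form a
  right ideal \<open>E\<close> of \<open>\<A>\<close>, and for an element \<open>Y\<close> of \<open>\<A>\<close> the matrix equations \<open>Y E = 0\<close> and
  \<open>Y\<^sup>* T\<^sub>x E = 0\<close> follow from only \<open>2 dim E\<close> scalar equations, namely orthogonality of \<open>Y\<^sup>*\<close> to \<open>E\<close> and
  of \<open>Y\<close> to \<open>T\<^sub>x E\<close> (\<open>orthogonal_to_ideal_annihilates\<close>).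

  Signs are then found by partial coloring (\<open>partial_coloring\<close>). Given a point of the cube with \<open>k\<close>
  live coordinates, maximise \<open>\<Sum> x\<^sub>l\<^sup>2 - \<mu> \<parallel>T\<^sub>x\<parallel>\<^sub>4\<^sup>4\<close> over the points of the cube at which
  \<open>T\<close> has moved by at most \<open>C\<close> in operator norm; here \<open>\<parallel>_\<parallel>\<^sub>4\<close> is the Schatten norm of the displacement.
  Comparison with the starting point bounds the Schatten norm at the maximum, hence the multiplicity
  \<open>dim E\<close> of the singular value \<open>C\<close>. If more than half of the coordinates were still live, there would
  be many orthonormal directions that touch live coordinates only and annihilate \<open>E\<close>. Along each of
  them one can move both ways without leaving the feasible set, because the remaining singular
  values are bounded away from \<open>C\<close> (\<open>op_bound_perturb\<close>). The second derivative of the objective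
  must therefore be nonpositive in all these directions; but summed over an orthonormal family the
  second derivative of the Schatten term is too small to compensate the one of \<open>\<Sum> x\<^sub>l\<^sup>2\<close>
  (\<open>schatten4_second_difference\<close>, \<open>sum_hs_sq_mult_transposed_le\<close>).

  With \<open>C = 8 (N k)\<^sup>1\<^sup>/\<^sup>4\<close> all estimates close. Since the number of live coordinates halves, iterating
  gives a geometric series, and \<open>(N n)\<^sup>1\<^sup>/\<^sup>4 \<le> (2 C\<^sub>0)\<^sup>1\<^sup>/\<^sup>4 \<surd>n\<close>. The fourth power of the Schatten norm is what makes the
  series converge: second moments alone would lose a factor \<open>log n\<close> here.
\<close>

section \<open>Orthonormal families in real coordinate spaces\<close>

definition dot :: "'a set \<Rightarrow> ('a \<Rightarrow> real) \<Rightarrow> ('a \<Rightarrow> real) \<Rightarrow> real" where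
  "dot J u v = (\<Sum>j\<in>J. u j * v j)"

text \<open>
  Families are indexed by an initial segment of the naturals, so that they can be extended one vector
  at a time.
\<close>

definition orthonormal :: "'a set \<Rightarrow> (nat \<Rightarrow> 'a \<Rightarrow> real) \<Rightarrow> nat \<Rightarrow> bool" where
  "orthonormal J w r \<longleftrightarrow> (\<forall>i<r. \<forall>j<r. dot J (w i) (w j) = (if i = j then 1 else 0))"

lemma dot_commute: "dot J u v = dot J v u"
  by (simp add: dot_def mult.commute)

lemma dot_self_nonneg: "0 \<le> dot J u u"
  by (simp add: dot_def sum_nonneg)

lemma dot_add_left: "dot J (\<lambda>j. u j + v j) w = dot J u w + dot J v w"
  by (simp add: dot_def algebra_simps sum.distrib)

lemma dot_add_right: "dot J w (\<lambda>j. u j + v j) = dot J w u + dot J w v"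
  by (simp add: dot_def algebra_simps sum.distrib)

lemma dot_diff_left: "dot J (\<lambda>j. u j - v j) w = dot J u w - dot J v w"
  by (simp add: dot_def algebra_simps sum_subtractf)

lemma dot_diff_right: "dot J w (\<lambda>j. u j - v j) = dot J w u - dot J w v"
  by (simp add: dot_def algebra_simps sum_subtractf)

lemma dot_scale_left: "dot J (\<lambda>j. c * u j) w = c * dot J u w"
  by (simp add: dot_def algebra_simps sum_distrib_left)

lemma dot_scale_right: "dot J w (\<lambda>j. c * u j) = c * dot J w u"
  by (simp add: dot_def algebra_simps sum_distrib_left)

lemma dot_sum_left: "dot J (\<lambda>j. \<Sum>i\<in>I. f i j) w = (\<Sum>i\<in>I. dot J (f i) w)"
  unfolding dot_def by (simp add: sum_distrib_right) (rule sum.swap)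

lemma dot_sum_right: "dot J w (\<lambda>j. \<Sum>i\<in>I. f i j) = (\<Sum>i\<in>I. dot J w (f i))"
  unfolding dot_def by (simp add: sum_distrib_left) (rule sum.swap)

lemmas dot_linear = dot_add_left dot_add_right dot_diff_left dot_diff_right
  dot_scale_left dot_scale_right dot_sum_left dot_sum_right

lemma dot_cong: "(\<And>j. j \<in> J \<Longrightarrow> u j = u' j) \<Longrightarrow> (\<And>j. j \<in> J \<Longrightarrow> v j = v' j) \<Longrightarrow> dot J u v = dot J u' v'"
  by (simp add: dot_def)

lemma dot_self_eq_0: "finite J \<Longrightarrow> dot J u u = 0 \<longleftrightarrow> (\<forall>j\<in>J. u j = 0)"
  by (auto simp: dot_def sum_nonneg_eq_0_iff)

lemma dot_eq_0_left: "(\<And>j. j \<in> J \<Longrightarrow> u j = 0) \<Longrightarrow> dot J u v = 0"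
  by (simp add: dot_def)

lemma dot_Cauchy_Schwarz: "(dot J u v)\<^sup>2 \<le> dot J u u * dot J v v"
  using Cauchy_Schwarz_ineq_sum[of u v J] by (simp add: dot_def power2_eq_square)

lemma bessel:
  assumes "orthonormal J w r"
  shows "(\<Sum>i<r. (dot J (w i) v)\<^sup>2) \<le> dot J v v"
proof -
  let ?p = "\<lambda>j. \<Sum>i<r. dot J (w i) v * w i j"
  have 1: "dot J ?p v = (\<Sum>i<r. (dot J (w i) v)\<^sup>2)"
    by (simp add: dot_linear power2_eq_square)
  have "dot J ?p ?p = (\<Sum>i<r. \<Sum>k<r. dot J (w i) v * (dot J (w k) v * dot J (w i) (w k)))"
    by (simp add: dot_linear sum_distrib_left)
  also have "\<dots> = (\<Sum>i<r. \<Sum>k<r. if k = i then (dot J (w i) v)\<^sup>2 else 0)"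
    using assms by (intro sum.cong refl) (auto simp: orthonormal_def power2_eq_square)
  finally have 2: "dot J ?p ?p = (\<Sum>i<r. (dot J (w i) v)\<^sup>2)"
    by simp
  have "0 \<le> dot J (\<lambda>j. v j - ?p j) (\<lambda>j. v j - ?p j)" by (rule dot_self_nonneg)
  also have "\<dots> = dot J v v - dot J ?p v - (dot J v ?p - dot J ?p ?p)"
    by (simp only: dot_diff_left dot_diff_right)
  finally show ?thesis using 1 2 dot_commute[of J v ?p] by simp
qed

text \<open>
  Bessel against each standard basis vector bounds the sum of the squared entries of the whole family.
\<close>

lemma orthonormal_length_le_card:
  assumes "finite J" "orthonormal J w r"
  shows "r \<le> card J"
proof -
  have "real r = (\<Sum>i<r. dot J (w i) (w i))" using assms(2) by (simp add: orthonormal_def)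
  also have "\<dots> = (\<Sum>j\<in>J. \<Sum>i<r. (w i j)\<^sup>2)"
    unfolding dot_def power2_eq_square by (rule sum.swap)
  also have "\<dots> \<le> (\<Sum>j\<in>J. 1)"
  proof (rule sum_mono)
    fix j assume j: "j \<in> J"
    let ?e = "\<lambda>k. if k = j then 1 else (0::real)"
    have "dot J u ?e = u j" for u
      using assms(1) j by (simp add: dot_def if_distrib cong: if_cong)
    then show "(\<Sum>i<r. (w i j)\<^sup>2) \<le> 1" using bessel[OF assms(2), of ?e] by simp
  qed
  finally show ?thesis by simp
qed

text \<open>
  Gaussian elimination: solve one equation for a pivot variable and substitute it into the others.
\<close>

lemma homogeneous_system_solvable:
  assumes "finite Q" "finite I" "card Q < card I"
  shows "\<exists>y::'i \<Rightarrow> real. (\<exists>i\<in>I. y i \<noteq> 0) \<and> (\<forall>i. i \<notin> I \<longrightarrow> y i = 0) \<and> (\<forall>q\<in>Q. dot I (c q) y = 0)"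
  using assms
proof (induction Q arbitrary: I c rule: finite_induct)
  case empty
  then obtain i where "i \<in> I" by fastforce
  then show ?case by (intro exI[of _ "\<lambda>j. if j = i then 1 else 0"]) auto
next
  case (insert q Q)
  show ?case
  proof (cases "\<forall>i\<in>I. c q i = 0")
    case True
    have "card Q < card I" using insert by simp
    then obtain y where "\<exists>i\<in>I. y i \<noteq> 0" "\<forall>i. i \<notin> I \<longrightarrow> y i = 0" "\<forall>q\<in>Q. dot I (c q) y = 0"
      using insert.IH[of I c] insert.prems by auto
    moreover have "dot I (c q) y = 0" using True by (simp add: dot_eq_0_left)
    ultimately show ?thesis by blast
  next
    case False
    then obtain p where p: "p \<in> I" "c q p \<noteq> 0" by blast
    let ?I = "I - {p}"
    let ?c = "\<lambda>q' i. c q' i - c q' p / c q p * c q i"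
    have "card Q < card ?I" using insert p by simp
    then obtain y where y: "\<exists>i\<in>?I. y i \<noteq> 0" "\<forall>i. i \<notin> ?I \<longrightarrow> y i = 0"
        "\<forall>q'\<in>Q. dot ?I (?c q') y = 0"
      using insert.IH[of ?I ?c] insert.prems by auto
    define z where "z = (\<lambda>i. if i = p then - dot ?I (c q) y / c q p else y i)"
    have z: "dot I (c q') z = dot ?I (c q') y - c q' p / c q p * dot ?I (c q) y" for q'
    proof -
      have "dot I (c q') z = c q' p * z p + dot ?I (c q') z"
        unfolding dot_def using p insert.prems by (simp add: sum.remove)
      moreover have "dot ?I (c q') z = dot ?I (c q') y"
        by (rule dot_cong) (auto simp: z_def)
      ultimately show ?thesis by (simp add: z_def)
    qed
    have "dot I (c q') z = 0" if "q' \<in> insert q Q" for q'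
      using that y(3) p(2) unfolding z by (auto simp only: dot_linear insert_iff) simp
    moreover have "\<exists>i\<in>I. z i \<noteq> 0" using y(1) by (auto simp: z_def)
    moreover have "\<forall>i. i \<notin> I \<longrightarrow> z i = 0" using y(2) p by (auto simp: z_def)
    ultimately show ?thesis by blast
  qed
qed

lemma orthonormal_extend:
  assumes "orthonormal J w r" "\<And>i. i < r \<Longrightarrow> dot J (w i) v = 0" "dot J v v = 1"
  shows "orthonormal J (w(r := v)) (Suc r)"
  using assms by (auto simp: orthonormal_def less_Suc_eq dot_commute)

text \<open>
  Grown one vector at a time: orthogonality to the vectors found so far just adds equations, and a
  solution exists as long as there are more unknowns than equations.
\<close>

lemma orthonormal_solutions:
  assumes "finite I" "s + q \<le> card I"
  shows "\<exists>y. orthonormal I y s \<and> (\<forall>a<s. (\<forall>i. i \<notin> I \<longrightarrow> y a i = 0) \<and> (\<forall>p<q. dot I (c p) (y a) = 0))"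
  using assms(2)
proof (induction s)
  case 0
  then show ?case by (simp add: orthonormal_def)
next
  case (Suc s)
  then obtain y where y: "orthonormal I y s"
    "\<forall>a<s. (\<forall>i. i \<notin> I \<longrightarrow> y a i = 0) \<and> (\<forall>p<q. dot I (c p) (y a) = 0)" by auto
  let ?c = "\<lambda>p. if p < q then c p else y (p - q)"
  obtain v where v: "\<exists>i\<in>I. v i \<noteq> 0" "\<forall>i. i \<notin> I \<longrightarrow> v i = 0" "\<forall>p<s+q. dot I (?c p) v = 0"
    using homogeneous_system_solvable[of "{..<s+q}" I ?c] assms(1) Suc.prems by auto
  have pos: "dot I v v > 0"
    using v(1) dot_self_eq_0[OF assms(1), of v] dot_self_nonneg[of I v] by fastforce
  define e where "e = (\<lambda>i. 1 / sqrt (dot I v v) * v i)"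
  have e: "dot I u e = dot I u v / sqrt (dot I v v)" for u
    unfolding e_def dot_scale_right by simp
  have "dot I e e = 1"
    unfolding e unfolding e_def dot_scale_left using pos by simp
  moreover have "dot I (c p) v = 0" if "p < q" for p using v(3)[rule_format, of p] that by simp
  moreover have "dot I (y a) v = 0" if "a < s" for a using v(3)[rule_format, of "q + a"] that by simp
  ultimately have "orthonormal I (y(s := e)) (Suc s)" "\<And>p. p < q \<Longrightarrow> dot I (c p) e = 0"
    using orthonormal_extend[OF y(1), of e] by (simp_all only: e)
  moreover have "\<forall>i. i \<notin> I \<longrightarrow> e i = 0" using v(2) by (simp add: e_def)
  ultimately show ?case
    using y(2) by (intro exI[of _ "y(s := e)"]) (simp add: less_Suc_eq fun_upd_def)
qed

text \<open>
  A longest orthonormal family inside a subspace, here given by its membership predicate \<open>P\<close>, is a basis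
  of it, since a nonzero remainder of an orthogonal expansion could be normalised and appended.
\<close>

lemma maximal_orthonormal:
  assumes "finite J" "\<And>u c. P u \<Longrightarrow> P (\<lambda>j. c * u j)"
    and sub: "\<And>u v. P u \<Longrightarrow> P v \<Longrightarrow> P (\<lambda>j. u j - v j)" and "P (\<lambda>j. 0)"
  obtains w r where "orthonormal J w r" "\<And>i. i < r \<Longrightarrow> P (w i)"
    "\<And>u. P u \<Longrightarrow> \<forall>j\<in>J. u j = (\<Sum>i<r. dot J (w i) u * w i j)"
proof -
  let ?good = "\<lambda>r. \<exists>w. orthonormal J w r \<and> (\<forall>i<r. P (w i))"
  have "?good 0" by (simp add: orthonormal_def)
  moreover have "\<And>r. ?good r \<Longrightarrow> r \<le> card J" using orthonormal_length_le_card[OF assms(1)] by blast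
  ultimately obtain r where "?good r" and max: "\<And>r'. ?good r' \<Longrightarrow> r' \<le> r"
    using Nat.ex_has_greatest_nat[of ?good 0 "card J"] by blast
  then obtain w where w: "orthonormal J w r" "\<And>i. i < r \<Longrightarrow> P (w i)" by blast
  have "\<forall>j\<in>J. u j = (\<Sum>i<r. dot J (w i) u * w i j)" if u: "P u" for u
  proof -
    have Psum: "P (\<lambda>j. \<Sum>i<k. c i * w i j)" if "k \<le> r" for k c
      using that
    proof (induction k)
      case (Suc k)
      have "P (\<lambda>j. (\<Sum>i<k. c i * w i j) - (- c k) * w k j)"
        using Suc w(2)[of k] by (intro sub assms(2)) auto
      then show ?case by simp
    qed (simp add: assms(4))
    define v where "v = (\<lambda>j. u j - (\<Sum>i<r. dot J (w i) u * w i j))"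
    have Pv: "P v" unfolding v_def using Psum[of r "\<lambda>i. dot J (w i) u"] u by (intro sub) auto
    have orth: "dot J (w a) v = 0" if "a < r" for a
    proof -
      have "dot J (w a) (\<lambda>j. \<Sum>i<r. dot J (w i) u * w i j) = (\<Sum>i<r. if i = a then dot J (w a) u else 0)"
        unfolding dot_sum_right dot_scale_right
        using w(1) that by (intro sum.cong refl) (auto simp: orthonormal_def)
      then show ?thesis using that by (simp add: v_def dot_diff_right)
    qed
    have "dot J v v = 0"
    proof (rule ccontr)
      assume "dot J v v \<noteq> 0"
      then have pos: "dot J v v > 0" using dot_self_nonneg[of J v] by simp
      define e where "e = (\<lambda>i. 1 / sqrt (dot J v v) * v i)"
      have e: "dot J x e = dot J x v / sqrt (dot J v v)" for x
        unfolding e_def dot_scale_right by simp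
      have "dot J e e = 1"
        unfolding e unfolding e_def dot_scale_left using pos by simp
      then have "orthonormal J (w(r := e)) (Suc r)"
        using orth by (intro orthonormal_extend[OF w(1)]) (auto simp: e)
      moreover have "P e" unfolding e_def by (rule assms(2)[OF Pv])
      ultimately have "?good (Suc r)" using w(2) by (intro exI[of _ "w(r := e)"]) (auto simp: less_Suc_eq)
      then show False using max[of "Suc r"] by simp
    qed
    then show ?thesis using dot_self_eq_0[OF assms(1), of v] by (simp add: v_def)
  qed
  with w show ?thesis by (rule that)
qed

section \<open>Singular values and the fourth Schatten norm of real matrices\<close>

definition mat_vec :: "nat \<Rightarrow> (nat \<Rightarrow> nat \<Rightarrow> real) \<Rightarrow> (nat \<Rightarrow> real) \<Rightarrow> nat \<Rightarrow> real" where
  "mat_vec N M w = (\<lambda>a. \<Sum>b<N. M a b * w b)"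

definition transposed :: "(nat \<Rightarrow> nat \<Rightarrow> real) \<Rightarrow> nat \<Rightarrow> nat \<Rightarrow> real" where
  "transposed M = (\<lambda>a b. M b a)"

definition lin_comb :: "'l set \<Rightarrow> ('l \<Rightarrow> real) \<Rightarrow> ('l \<Rightarrow> nat \<Rightarrow> nat \<Rightarrow> real) \<Rightarrow> nat \<Rightarrow> nat \<Rightarrow> real" where
  "lin_comb I z T = (\<lambda>a b. \<Sum>l\<in>I. z l * T l a b)"

definition op_bound :: "nat \<Rightarrow> (nat \<Rightarrow> nat \<Rightarrow> real) \<Rightarrow> real \<Rightarrow> bool" where
  "op_bound N M c \<longleftrightarrow> (\<forall>w. dot {..<N} (mat_vec N M w) (mat_vec N M w) \<le> c\<^sup>2 * dot {..<N} w w)"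

text \<open>The product \<open>M Y\<^sup>T\<close>. Every product below has this shape, possibly after transposing both factors.\<close>

definition mult_transposed :: "nat \<Rightarrow> (nat \<Rightarrow> nat \<Rightarrow> real) \<Rightarrow> (nat \<Rightarrow> nat \<Rightarrow> real) \<Rightarrow> nat \<Rightarrow> nat \<Rightarrow> real" where
  "mult_transposed N M Y = (\<lambda>a b. \<Sum>i<N. M a i * Y b i)"

definition hs_sq :: "nat \<Rightarrow> (nat \<Rightarrow> nat \<Rightarrow> real) \<Rightarrow> real" where
  "hs_sq N M = (\<Sum>a<N. \<Sum>b<N. (M a b)\<^sup>2)"

text \<open>The squared Hilbert-Schmidt norm of \<open>M\<^sup>T M\<close>, that is, the sum of the fourth powers of the singular values of \<open>M\<close>.\<close>

definition schatten4 :: "nat \<Rightarrow> (nat \<Rightarrow> nat \<Rightarrow> real) \<Rightarrow> real" where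
  "schatten4 N M = hs_sq N (mult_transposed N (transposed M) (transposed M))"

text \<open>
  The eigenvector equation \<open>M\<^sup>T M u = C\<^sup>2 u\<close> in weak form, so that it carries over to the algebra without
  mentioning the transpose.
\<close>

definition top_singular :: "nat \<Rightarrow> (nat \<Rightarrow> nat \<Rightarrow> real) \<Rightarrow> real \<Rightarrow> (nat \<Rightarrow> real) \<Rightarrow> bool" where
  "top_singular N M C u \<longleftrightarrow> (\<forall>h. dot {..<N} (mat_vec N M u) (mat_vec N M h) = C\<^sup>2 * dot {..<N} u h)"

lemma transposed_transposed [simp]: "transposed (transposed M) = M"
  by (simp add: transposed_def)

lemma hs_sq_nonneg: "0 \<le> hs_sq N M"
  by (simp add: hs_sq_def sum_nonneg)

lemma hs_sq_transposed [simp]: "hs_sq N (transposed M) = hs_sq N M"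
  unfolding hs_sq_def transposed_def by (rule sum.swap)

lemma hs_sq_rows: "hs_sq N M = (\<Sum>a<N. dot {..<N} (M a) (M a))"
  by (simp add: hs_sq_def dot_def power2_eq_square)

lemma mat_vec_add: "mat_vec N M (\<lambda>j. u j + v j) = (\<lambda>a. mat_vec N M u a + mat_vec N M v a)"
  by (simp add: mat_vec_def algebra_simps sum.distrib)

lemma mat_vec_diff: "mat_vec N M (\<lambda>j. u j - v j) = (\<lambda>a. mat_vec N M u a - mat_vec N M v a)"
  by (simp add: mat_vec_def algebra_simps sum_subtractf)

lemma mat_vec_scale: "mat_vec N M (\<lambda>j. c * u j) = (\<lambda>a. c * mat_vec N M u a)"
  by (simp add: mat_vec_def algebra_simps sum_distrib_left)

lemma mat_vec_sum: "mat_vec N M (\<lambda>j. \<Sum>i\<in>I. f i j) = (\<lambda>a. \<Sum>i\<in>I. mat_vec N M (f i) a)"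
  unfolding mat_vec_def by (rule ext, simp only: sum_distrib_left, rule sum.swap)

lemma mat_vec_matrix_add: "mat_vec N (\<lambda>a b. M a b + t * Y a b) u = (\<lambda>a. mat_vec N M u a + t * mat_vec N Y u a)"
  by (simp add: mat_vec_def algebra_simps sum.distrib sum_distrib_left)

lemma mat_vec_cong: "(\<And>j. j < N \<Longrightarrow> u j = v j) \<Longrightarrow> mat_vec N M u = mat_vec N M v"
  by (simp add: mat_vec_def)

lemma mat_vec_lin_comb: "mat_vec N (lin_comb I z T) w = (\<lambda>a. \<Sum>l\<in>I. z l * mat_vec N (T l) w a)"
  unfolding mat_vec_def lin_comb_def
  by (rule ext, simp add: sum_distrib_left sum_distrib_right algebra_simps, rule sum.swap)

lemma transposed_lin_comb: "transposed (lin_comb I z T) = lin_comb I z (\<lambda>l. transposed (T l))"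
  by (simp add: transposed_def lin_comb_def)

lemma dot_mat_vec: "dot {..<N} u (mat_vec N M w) = dot {..<N} (mat_vec N (transposed M) u) w"
  unfolding dot_def mat_vec_def transposed_def
  by (simp add: sum_distrib_left sum_distrib_right mult.assoc mult.left_commute) (rule sum.swap)

text \<open>
  \<open>\<parallel>M\<^sup>T u\<parallel>\<^sup>2 = \<langle>u, M M\<^sup>T u\<rangle> \<le> c \<parallel>u\<parallel> \<parallel>M\<^sup>T u\<parallel>\<close>; cancel one factor.
\<close>

lemma op_bound_transposed:
  assumes "op_bound N M c"
  shows "op_bound N (transposed M) c"
  unfolding op_bound_def
proof
  fix u
  let ?v = "mat_vec N (transposed M) u"
  let ?p = "dot {..<N} ?v ?v"
  have "?p = dot {..<N} u (mat_vec N M ?v)" by (simp add: dot_mat_vec)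
  then have "?p\<^sup>2 \<le> dot {..<N} u u * dot {..<N} (mat_vec N M ?v) (mat_vec N M ?v)"
    using dot_Cauchy_Schwarz by metis
  also have "\<dots> \<le> dot {..<N} u u * (c\<^sup>2 * ?p)"
    using assms by (intro mult_left_mono) (auto simp: op_bound_def dot_self_nonneg)
  finally have "?p * ?p \<le> (c\<^sup>2 * dot {..<N} u u) * ?p"
    by (simp add: power2_eq_square algebra_simps)
  then show "?p \<le> c\<^sup>2 * dot {..<N} u u"
    using dot_self_nonneg[of "{..<N}" ?v] dot_self_nonneg[of "{..<N}" u]
    by (cases "?p = 0") (auto simp: mult_le_cancel_right)
qed

lemma op_bound_add:
  assumes "op_bound N M a" "op_bound N M' b" "0 \<le> a" "0 \<le> b"
  shows "op_bound N (\<lambda>i j. M i j + M' i j) (a + b)"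
  unfolding op_bound_def
proof
  fix w
  let ?u = "mat_vec N M w" and ?v = "mat_vec N M' w" and ?n = "dot {..<N} w w"
  have u: "dot {..<N} ?u ?u \<le> a\<^sup>2 * ?n" and v: "dot {..<N} ?v ?v \<le> b\<^sup>2 * ?n"
    using assms by (auto simp: op_bound_def)
  have "(dot {..<N} ?u ?v)\<^sup>2 \<le> (a\<^sup>2 * ?n) * (b\<^sup>2 * ?n)"
    by (rule order.trans[OF dot_Cauchy_Schwarz]) (intro mult_mono u v mult_nonneg_nonneg dot_self_nonneg zero_le_power2)
  also have "\<dots> = (a * b * ?n)\<^sup>2" by (simp add: power2_eq_square algebra_simps)
  finally have "dot {..<N} ?u ?v \<le> a * b * ?n"
    by (rule power2_le_imp_le) (simp add: assms(3,4) dot_self_nonneg)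
  moreover have "mat_vec N (\<lambda>i j. M i j + M' i j) w = (\<lambda>i. ?u i + ?v i)"
    using mat_vec_matrix_add[of N M 1 M' w] by simp
  ultimately show "dot {..<N} (mat_vec N (\<lambda>i j. M i j + M' i j) w) (mat_vec N (\<lambda>i j. M i j + M' i j) w) \<le> (a + b)\<^sup>2 * ?n"
    using u v dot_commute[of "{..<N}" ?u ?v] by (simp add: dot_linear power2_eq_square algebra_simps)
qed

lemma op_bound_mono: "op_bound N M a \<Longrightarrow> 0 \<le> a \<Longrightarrow> a \<le> b \<Longrightarrow> op_bound N M b"
  unfolding op_bound_def
  by (meson dot_self_nonneg mult_right_mono order_trans power_mono)

lemma mat_vec_le_hs_sq: "dot {..<N} (mat_vec N Y u) (mat_vec N Y u) \<le> hs_sq N Y * dot {..<N} u u"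
proof -
  have "dot {..<N} (mat_vec N Y u) (mat_vec N Y u) = (\<Sum>a<N. (dot {..<N} (Y a) u)\<^sup>2)"
    by (simp add: dot_def mat_vec_def power2_eq_square)
  also have "\<dots> \<le> (\<Sum>a<N. dot {..<N} (Y a) (Y a) * dot {..<N} u u)"
    by (intro sum_mono dot_Cauchy_Schwarz)
  finally show ?thesis by (simp add: hs_sq_rows sum_distrib_right)
qed

text \<open>
  Cauchy-Schwarz for the trace of the Gram matrix \<open>M\<^sup>T M\<close> against the \<open>N\<close> ones on the diagonal.
\<close>

lemma hs_sq_squared_le_schatten4: "(hs_sq N M)\<^sup>2 \<le> real N * schatten4 N M"
proof -
  let ?G = "mult_transposed N (transposed M) (transposed M)"
  have "hs_sq N M = (\<Sum>i<N. 1 * ?G i i)"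
    unfolding hs_sq_def mult_transposed_def transposed_def by (simp add: power2_eq_square) (rule sum.swap)
  then have "(hs_sq N M)\<^sup>2 \<le> (\<Sum>i<N. 1\<^sup>2) * (\<Sum>i<N. (?G i i)\<^sup>2)"
    by (simp only: Cauchy_Schwarz_ineq_sum)
  also have "\<dots> \<le> real N * schatten4 N M"
    unfolding schatten4_def hs_sq_def by (simp, intro mult_left_mono sum_mono member_le_sum) auto
  finally show ?thesis .
qed

text \<open>
  The cyclic property \<open>tr (M\<^sup>T M Y\<^sup>T Y) = tr (M Y\<^sup>T Y M\<^sup>T)\<close>, which makes the cross term of the second difference a square.
\<close>

lemma sum_gram_products:
  "(\<Sum>i<N. \<Sum>j<N. mult_transposed N (transposed M) (transposed M) i j * mult_transposed N (transposed Y) (transposed Y) i j) = hs_sq N (mult_transposed N M Y)"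
proof -
  have "hs_sq N (mult_transposed N M Y) = (\<Sum>a<N. \<Sum>b<N. \<Sum>i<N. \<Sum>j<N. (M a i * M a j) * (Y b i * Y b j))"
    by (simp add: hs_sq_def mult_transposed_def power2_eq_square sum_product algebra_simps)
  also have "\<dots> = (\<Sum>a<N. \<Sum>i<N. \<Sum>b<N. \<Sum>j<N. (M a i * M a j) * (Y b i * Y b j))"
    by (intro sum.cong refl sum.swap)
  also have "\<dots> = (\<Sum>i<N. \<Sum>a<N. \<Sum>b<N. \<Sum>j<N. (M a i * M a j) * (Y b i * Y b j))"
    by (rule sum.swap)
  also have "\<dots> = (\<Sum>i<N. \<Sum>a<N. \<Sum>j<N. \<Sum>b<N. (M a i * M a j) * (Y b i * Y b j))"
    by (intro sum.cong refl sum.swap)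
  also have "\<dots> = (\<Sum>i<N. \<Sum>j<N. \<Sum>a<N. \<Sum>b<N. (M a i * M a j) * (Y b i * Y b j))"
    by (intro sum.cong refl sum.swap)
  finally show ?thesis by (simp add: mult_transposed_def transposed_def sum_product)
qed

text \<open>
  The Gram matrix of \<open>M \<plusminus> t Y\<close> is \<open>G \<plusminus> t (P + P\<^sup>T) + t\<^sup>2 J\<close> with \<open>P = M\<^sup>T Y\<close>. First-order terms cancel in
  the sum, and what remains at order \<open>t\<^sup>2\<close> is bounded by positive quadratic forms in \<open>Y\<close>, so that it can be
  summed over an orthonormal family of directions.
\<close>

lemma schatten4_second_difference:
  "schatten4 N (\<lambda>a b. M a b + t * Y a b) + schatten4 N (\<lambda>a b. M a b - t * Y a b)
    \<le> 2 * schatten4 N M + 2 * t\<^sup>2 * (2 * hs_sq N (mult_transposed N M Y) + 4 * hs_sq N (mult_transposed N (transposed M) (transposed Y))) + 2 * t^4 * schatten4 N Y"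
proof -
  let ?G = "mult_transposed N (transposed M) (transposed M)" and ?J = "mult_transposed N (transposed Y) (transposed Y)" and ?P = "mult_transposed N (transposed M) (transposed Y)"
  have ex: "mult_transposed N (transposed (\<lambda>a b. M a b + s * Y a b)) (transposed (\<lambda>a b. M a b + s * Y a b)) i j
      = ?G i j + s * (?P i j + ?P j i) + s\<^sup>2 * ?J i j" for s i j
    by (simp add: mult_transposed_def transposed_def algebra_simps sum.distrib sum_distrib_left power2_eq_square)
  have pt: "(g + t * (p + q) + t\<^sup>2 * y)\<^sup>2 + (g + (-t) * (p + q) + (-t)\<^sup>2 * y)\<^sup>2
      \<le> 2 * g\<^sup>2 + 4 * t\<^sup>2 * (g * y) + 4 * t\<^sup>2 * p\<^sup>2 + 4 * t\<^sup>2 * q\<^sup>2 + 2 * t^4 * y\<^sup>2" for g p q y :: real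
  proof -
    have "2 * g\<^sup>2 + 4 * t\<^sup>2 * (g * y) + 4 * t\<^sup>2 * p\<^sup>2 + 4 * t\<^sup>2 * q\<^sup>2 + 2 * t^4 * y\<^sup>2
       - ((g + t * (p + q) + t\<^sup>2 * y)\<^sup>2 + (g + (-t) * (p + q) + (-t)\<^sup>2 * y)\<^sup>2) = 2 * (t * (p - q))\<^sup>2"
      by (simp add: power2_eq_square power4_eq_xxxx algebra_simps)
    then show ?thesis by (smt (verit) zero_le_power2)
  qed
  have "schatten4 N (\<lambda>a b. M a b + t * Y a b) + schatten4 N (\<lambda>a b. M a b + (-t) * Y a b)
     = (\<Sum>i<N. \<Sum>j<N. (?G i j + t * (?P i j + ?P j i) + t\<^sup>2 * ?J i j)\<^sup>2
        + (?G i j + (-t) * (?P i j + ?P j i) + (-t)\<^sup>2 * ?J i j)\<^sup>2)"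
    unfolding schatten4_def hs_sq_def ex by (simp only: sum.distrib)
  also have "\<dots> \<le> (\<Sum>i<N. \<Sum>j<N. 2 * (?G i j)\<^sup>2 + 4 * t\<^sup>2 * (?G i j * ?J i j)
       + 4 * t\<^sup>2 * (?P i j)\<^sup>2 + 4 * t\<^sup>2 * (?P j i)\<^sup>2 + 2 * t^4 * (?J i j)\<^sup>2)"
    by (intro sum_mono pt)
  also have "\<dots> = 2 * schatten4 N M + 4 * t\<^sup>2 * hs_sq N (mult_transposed N M Y) + 4 * t\<^sup>2 * hs_sq N ?P
       + 4 * t\<^sup>2 * hs_sq N (transposed ?P) + 2 * t^4 * schatten4 N Y"
    unfolding sum_gram_products[of N M Y, symmetric] unfolding schatten4_def hs_sq_def transposed_def
    by (simp add: sum.distrib sum_distrib_left)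
  finally show ?thesis by (simp add: algebra_simps)
qed

text \<open>
  Each entry of \<open>M Y\<^sup>T\<close> is linear in the coefficients of \<open>Y\<close>, so Bessel replaces the sum over the family
  by a sum over the generators \<open>T l\<close>, and these are contractions.
\<close>

lemma sum_hs_sq_mult_transposed_le:
  assumes "orthonormal I y s" "finite I" "\<And>l. l \<in> I \<Longrightarrow> op_bound N (T l) 1"
  shows "(\<Sum>p<s. hs_sq N (mult_transposed N M (lin_comb I (y p) T))) \<le> real (card I) * hs_sq N M"
proof -
  have eq: "mult_transposed N M (lin_comb I (y p) T) a b = dot I (y p) (\<lambda>l. mat_vec N (T l) (M a) b)" for p a b
    unfolding mult_transposed_def lin_comb_def dot_def mat_vec_def
    by (simp add: sum_distrib_left sum_distrib_right algebra_simps) (rule sum.swap)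
  have "(\<Sum>p<s. hs_sq N (mult_transposed N M (lin_comb I (y p) T)))
      = (\<Sum>a<N. \<Sum>p<s. \<Sum>b<N. (dot I (y p) (\<lambda>l. mat_vec N (T l) (M a) b))\<^sup>2)"
    unfolding hs_sq_def eq by (rule sum.swap)
  also have "\<dots> = (\<Sum>a<N. \<Sum>b<N. \<Sum>p<s. (dot I (y p) (\<lambda>l. mat_vec N (T l) (M a) b))\<^sup>2)"
    by (intro sum.cong refl sum.swap)
  also have "\<dots> \<le> (\<Sum>a<N. \<Sum>b<N. dot I (\<lambda>l. mat_vec N (T l) (M a) b) (\<lambda>l. mat_vec N (T l) (M a) b))"
    by (intro sum_mono bessel assms)
  also have "\<dots> = (\<Sum>a<N. \<Sum>l\<in>I. dot {..<N} (mat_vec N (T l) (M a)) (mat_vec N (T l) (M a)))"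
    unfolding dot_def by (intro sum.cong refl sum.swap)
  also have "\<dots> \<le> (\<Sum>a<N. \<Sum>l\<in>I. dot {..<N} (M a) (M a))"
    using assms(3) by (intro sum_mono) (auto simp: op_bound_def)
  also have "\<dots> = real (card I) * hs_sq N M"
    by (simp add: hs_sq_rows sum_distrib_left)
  finally show ?thesis .
qed

text \<open>
  The positive semidefinite form \<open>C\<^sup>2 \<langle>u, h\<rangle> - \<langle>M u, M h\<rangle>\<close> vanishes on the diagonal at \<open>u\<close>, hence pairs \<open>u\<close> to
  zero with every \<open>h\<close>.
\<close>

lemma top_singular_if_norm_attained:
  assumes "op_bound N M C" "dot {..<N} (mat_vec N M u) (mat_vec N M u) = C\<^sup>2 * dot {..<N} u u"
  shows "top_singular N M C u"
  unfolding top_singular_def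
proof
  fix h
  define B where "B = (\<lambda>u h. C\<^sup>2 * dot {..<N} u h - dot {..<N} (mat_vec N M u) (mat_vec N M h))"
  define b \<beta> where "b = B u h" and "\<beta> = B h h"
  \<comment> \<open>Nearly the minimiser \<open>- b / \<beta>\<close> of \<open>2 \<tau> b + \<tau>\<^sup>2 \<beta>\<close>, but defined also for \<open>\<beta> = 0\<close>.\<close>
  define \<tau> where "\<tau> = - b / (\<beta> + 1)"
  have nn: "0 \<le> B v v" for v using assms(1) by (auto simp: B_def op_bound_def)
  have "0 \<le> B (\<lambda>j. u j + \<tau> * h j) (\<lambda>j. u j + \<tau> * h j)" by (rule nn)
  also have "\<dots> = 2 * \<tau> * b + \<tau>\<^sup>2 * \<beta>"
    unfolding b_def \<beta>_def B_def mat_vec_add mat_vec_scale dot_linear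
    using assms(2) dot_commute[of "{..<N}" u h] dot_commute[of "{..<N}" "mat_vec N M u" "mat_vec N M h"]
    by (simp add: algebra_simps power2_eq_square)
  also have "\<dots> = - b\<^sup>2 * (\<beta> + 2) / (\<beta> + 1)\<^sup>2"
    using nn[of h] unfolding \<tau>_def \<beta>_def[symmetric]
    by (simp add: divide_simps power2_eq_square) (simp add: algebra_simps)
  finally have "b\<^sup>2 * (\<beta> + 2) \<le> 0"
    using nn[of h] unfolding \<beta>_def[symmetric] by (simp add: divide_simps mult_le_0_iff split: if_splits)
  then have "b = 0" using nn[of h] unfolding \<beta>_def[symmetric] by (simp add: mult_le_0_iff)
  then show "dot {..<N} (mat_vec N M u) (mat_vec N M h) = C\<^sup>2 * dot {..<N} u h" by (simp add: b_def B_def)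
qed

lemma compact_PiE_UNIV:
  fixes X :: "'i \<Rightarrow> 'b::topological_space set"
  assumes "\<And>i. compact (X i)"
  shows "compact (PiE UNIV X)"
  using assms compactin_PiE[of "\<lambda>_. euclidean" UNIV X]
  by (simp add: euclidean_product_topology)

lemma continuous_on_coordinate: "continuous_on S (\<lambda>x::'i \<Rightarrow> real. x i)"
  by (rule continuous_on_subset[OF continuous_on_product_coordinates]) simp

lemma continuous_on_dot [continuous_intros]:
  "(\<And>j. j \<in> J \<Longrightarrow> continuous_on S (\<lambda>x. f x j)) \<Longrightarrow> (\<And>j. j \<in> J \<Longrightarrow> continuous_on S (\<lambda>x. g x j)) \<Longrightarrow>
   continuous_on S (\<lambda>x. dot J (f x) (g x))"
  unfolding dot_def by (intro continuous_intros)

text \<open>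
  Vectors are functions on all of the naturals; setting the entries from \<open>N\<close> on to zero is what makes the sphere compact.
\<close>

lemma compact_unit_sphere:
  "compact {u \<in> PiE UNIV (\<lambda>i. if i < N then {-1..1} else {0::real}).
      dot {..<N} u u = 1 \<and> (\<forall>i<r. dot {..<N} (w i) u = 0)}" (is "compact ?S")
proof -
  have "?S = PiE UNIV (\<lambda>i. if i < N then {-1..1} else {0::real}) \<inter>
      ({u. dot {..<N} u u = 1} \<inter> (\<Inter>i\<in>{..<r}. {u. dot {..<N} (w i) u = 0}))" by auto
  moreover have "closed {u. dot {..<N} u u = (1::real)}"
    by (intro closed_Collect_eq continuous_intros continuous_on_coordinate)
  moreover have "closed {u. dot {..<N} (w i) u = (0::real)}" for i
    by (intro closed_Collect_eq continuous_intros continuous_on_coordinate)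
  ultimately show ?thesis
    by (auto intro!: compact_Int_closed compact_PiE_UNIV closed_Int closed_INT)
qed

text \<open>
  By compactness \<open>\<parallel>M u\<parallel>\<close> attains its maximum over the unit vectors orthogonal to the top singular space. If
  that maximum were \<open>C\<close>, the maximiser would itself be a top singular vector.
\<close>

lemma spectral_gap:
  assumes nl: "op_bound N M C" and "C > 0"
    and span: "\<And>u. top_singular N M C u \<Longrightarrow> \<forall>j\<in>{..<N}. u j = (\<Sum>i<r. dot {..<N} (w i) u * w i j)"
  shows "\<exists>c\<ge>0. c < C\<^sup>2 \<and> (\<forall>u. (\<forall>i<r. dot {..<N} (w i) u = 0) \<longrightarrow>
    dot {..<N} (mat_vec N M u) (mat_vec N M u) \<le> c * dot {..<N} u u)"
proof -
  let ?S = "{u \<in> PiE UNIV (\<lambda>i. if i < N then {-1..1} else {0::real}).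
      dot {..<N} u u = 1 \<and> (\<forall>i<r. dot {..<N} (w i) u = 0)}"
  let ?f = "\<lambda>u. dot {..<N} (mat_vec N M u) (mat_vec N M u)"
  have "\<exists>c\<ge>0. c < C\<^sup>2 \<and> (\<forall>u\<in>?S. ?f u \<le> c)"
  proof (cases "?S = {}")
    case True
    then show ?thesis using \<open>C > 0\<close> by (intro exI[of _ 0]) auto
  next
    case False
    have cont: "continuous_on ?S ?f"
      unfolding mat_vec_def by (intro continuous_intros continuous_on_coordinate)
    obtain u where u: "u \<in> ?S" "\<And>v. v \<in> ?S \<Longrightarrow> ?f v \<le> ?f u"
      using continuous_attains_sup[OF compact_unit_sphere False cont] by (elim bexE) (rule that, auto)
    have "?f u \<noteq> C\<^sup>2"
    proof
      assume "?f u = C\<^sup>2"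
      then have "top_singular N M C u" using nl u(1) by (intro top_singular_if_norm_attained) auto
      then have "u j = 0" if "j < N" for j using span[of u] u(1) that by auto
      then have "dot {..<N} u u = 0" by (intro dot_eq_0_left) auto
      then show False using u(1) by simp
    qed
    moreover have "?f u \<le> C\<^sup>2" using nl u(1) by (auto simp: op_bound_def dest: spec[of _ u])
    ultimately show ?thesis using u(2) by (intro exI[of _ "?f u"]) (auto simp: dot_self_nonneg)
  qed
  then obtain c where c: "c \<ge> 0" "c < C\<^sup>2" "\<And>u. u \<in> ?S \<Longrightarrow> ?f u \<le> c" by blast
  have "?f u \<le> c * dot {..<N} u u" if orth: "\<forall>i<r. dot {..<N} (w i) u = 0" for u
  proof (cases "dot {..<N} u u = 0")
    case True
    then have "?f u \<le> 0" using nl by (auto simp: op_bound_def dest: spec[of _ u])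
    then show ?thesis using True by simp
  next
    case False
    then have pos: "dot {..<N} u u > 0" using dot_self_nonneg[of "{..<N}" u] by simp
    define s where "s = 1 / sqrt (dot {..<N} u u)"
    have s2: "s * s = 1 / dot {..<N} u u" using pos by (simp add: s_def)
    define v where "v = (\<lambda>j. if j < N then s * u j else 0)"
    have vd: "dot {..<N} x v = s * dot {..<N} x u" for x
      unfolding dot_scale_right[symmetric] by (rule dot_cong) (auto simp: v_def)
    have vv: "dot {..<N} v v = 1"
      unfolding vd using s2 pos by (simp add: dot_commute[of _ v] vd flip: mult.assoc)
    have "v j * v j \<le> 1" if "j < N" for j
      using vv that member_le_sum[of j "{..<N}" "\<lambda>j. v j * v j"] by (simp add: dot_def)
    then have "\<bar>v j\<bar> \<le> 1" if "j < N" for j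
      using that abs_square_le_1[of "v j"] by (simp add: power2_eq_square)
    then have "v \<in> PiE UNIV (\<lambda>i. if i < N then {-1..1} else {0})"
      by (auto simp: v_def abs_le_iff)
    then have "v \<in> ?S" using vv orth by (simp add: vd)
    then have "?f v \<le> c" by (rule c(3))
    moreover have "mat_vec N M v = (\<lambda>a. s * mat_vec N M u a)"
      unfolding mat_vec_scale[symmetric] by (rule mat_vec_cong) (simp add: v_def)
    ultimately have "(s * s) * ?f u \<le> c" by (simp add: dot_linear)
    then show ?thesis using pos by (simp add: s2 field_simps)
  qed
  with c show ?thesis by blast
qed

text \<open>
  If \<open>Y\<close> kills the top singular space \<open>E\<close> and its transpose kills \<open>M E\<close>, then \<open>M + t Y\<close> agrees with \<open>M\<close> on \<open>E\<close> and
  maps the orthogonal complement of \<open>E\<close> into that of \<open>M E\<close>. On the complement the spectral gap leaves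
  room for a small \<open>t\<close> of either sign.
\<close>

lemma op_bound_perturb:
  assumes nl: "op_bound N M C" and "C > 0"
    and orth: "orthonormal {..<N} w r"
    and top: "\<And>i. i < r \<Longrightarrow> top_singular N M C (w i)"
    and span: "\<And>u. top_singular N M C u \<Longrightarrow> \<forall>j\<in>{..<N}. u j = (\<Sum>i<r. dot {..<N} (w i) u * w i j)"
    and Y0: "\<And>i a. i < r \<Longrightarrow> a < N \<Longrightarrow> mat_vec N Y (w i) a = 0"
    and YT0: "\<And>i a. i < r \<Longrightarrow> a < N \<Longrightarrow> mat_vec N (transposed Y) (mat_vec N M (w i)) a = 0"
  shows "\<exists>\<delta>>0. \<forall>t. \<bar>t\<bar> \<le> \<delta> \<longrightarrow> op_bound N (\<lambda>a b. M a b + t * Y a b) C"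
proof -
  obtain c where c: "c \<ge> 0" "c < C\<^sup>2" and gap: "\<And>u. \<forall>i<r. dot {..<N} (w i) u = 0 \<Longrightarrow>
    dot {..<N} (mat_vec N M u) (mat_vec N M u) \<le> c * dot {..<N} u u"
    using spectral_gap[OF nl \<open>C > 0\<close> span] by blast
  define \<kappa> where "\<kappa> = hs_sq N Y"
  have \<kappa>: "0 \<le> \<kappa>" by (simp add: \<kappa>_def hs_sq_nonneg)
  define D where "D = C\<^sup>2 + 2 * \<kappa> + 1"
  have D: "D > 0" using \<kappa> by (simp add: D_def add_nonneg_pos)
  define \<delta> where "\<delta> = min 1 ((C\<^sup>2 - c) / D)"
  have \<delta>: "\<delta> > 0" using c D by (simp add: \<delta>_def)
  have "dot {..<N} (mat_vec N (\<lambda>a b. M a b + t * Y a b) u) (mat_vec N (\<lambda>a b. M a b + t * Y a b) u)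
      \<le> C\<^sup>2 * dot {..<N} u u" if t: "\<bar>t\<bar> \<le> \<delta>" for t u
  proof -
    let ?M = "\<lambda>a b. M a b + t * Y a b"
    define p where "p = (\<lambda>j. \<Sum>i<r. dot {..<N} (w i) u * w i j)"
    define v where "v = (\<lambda>j. u j - p j)"
    have v0: "dot {..<N} (w i) v = 0" if "i < r" for i
    proof -
      have "dot {..<N} (w i) p = (\<Sum>k<r. if k = i then dot {..<N} (w i) u else 0)"
        unfolding p_def dot_sum_right dot_scale_right
        using orth that by (intro sum.cong refl) (auto simp: orthonormal_def)
      then show ?thesis using that by (simp add: v_def dot_diff_right)
    qed
    have pv: "dot {..<N} p v = 0"
      unfolding p_def dot_sum_left dot_scale_left using v0 by simp
    have top_p: "dot {..<N} (mat_vec N M p) (mat_vec N M h) = C\<^sup>2 * dot {..<N} p h" for h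
      unfolding p_def mat_vec_sum mat_vec_scale dot_sum_left dot_scale_left
      using top by (simp add: top_singular_def sum_distrib_left algebra_simps)
    have Yp: "mat_vec N Y p a = 0" if "a < N" for a
      unfolding p_def mat_vec_sum mat_vec_scale using Y0 that by simp
    have YTp: "dot {..<N} (mat_vec N M p) (mat_vec N Y v) = 0"
    proof -
      have "mat_vec N (transposed Y) (mat_vec N M p) a = 0" if "a < N" for a
        unfolding p_def mat_vec_sum mat_vec_scale using YT0 that by simp
      then show ?thesis unfolding dot_mat_vec by (intro dot_eq_0_left) auto
    qed
    have u: "u = (\<lambda>j. p j + v j)" by (simp add: v_def)
    have uu: "dot {..<N} u u = dot {..<N} p p + dot {..<N} v v"
      unfolding u dot_add_left dot_add_right using pv dot_commute[of "{..<N}" p v] by simp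
    let ?V = "mat_vec N ?M v"
    have "dot {..<N} (mat_vec N ?M u) (mat_vec N ?M u) = dot {..<N} (\<lambda>a. mat_vec N M p a + ?V a) (\<lambda>a. mat_vec N M p a + ?V a)"
      by (rule dot_cong) (auto simp: u mat_vec_add mat_vec_matrix_add Yp)
    also have "\<dots> = dot {..<N} (mat_vec N M p) (mat_vec N M p) + 2 * dot {..<N} (mat_vec N M p) ?V + dot {..<N} ?V ?V"
      unfolding dot_add_left dot_add_right using dot_commute[of "{..<N}" "mat_vec N M p" ?V] by simp
    also have "dot {..<N} (mat_vec N M p) ?V = 0"
      unfolding mat_vec_matrix_add dot_add_right dot_scale_right by (simp add: top_p pv YTp)
    also have "dot {..<N} ?V ?V \<le> C\<^sup>2 * dot {..<N} v v"
    proof -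
      let ?m = "mat_vec N M v" and ?y = "mat_vec N Y v"
      define A B X n where "A = dot {..<N} ?m ?m" and "B = dot {..<N} ?y ?y"
        and "X = dot {..<N} ?m ?y" and "n = dot {..<N} v v"
      have n: "0 \<le> n" by (simp add: n_def dot_self_nonneg)
      have A: "A \<le> c * n" "0 \<le> A" using gap[of v] v0 by (auto simp: A_def n_def dot_self_nonneg)
      have B: "B \<le> \<kappa> * n" "0 \<le> B" by (auto simp: B_def n_def \<kappa>_def mat_vec_le_hs_sq dot_self_nonneg)
      have "0 \<le> dot {..<N} (\<lambda>a. ?m a + ?y a) (\<lambda>a. ?m a + ?y a)"
        "0 \<le> dot {..<N} (\<lambda>a. ?m a - ?y a) (\<lambda>a. ?m a - ?y a)" by (rule dot_self_nonneg)+
      then have X: "2 * \<bar>X\<bar> \<le> A + B"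
        unfolding dot_linear A_def B_def X_def using dot_commute[of "{..<N}" ?m ?y] by simp
      have t1: "\<bar>t\<bar> \<le> 1" "\<bar>t\<bar> * D \<le> C\<^sup>2 - c"
        using t D by (simp_all add: \<delta>_def flip: pos_le_divide_eq)
      have "dot {..<N} ?V ?V = A + t * (2 * X) + t\<^sup>2 * B"
        unfolding mat_vec_matrix_add dot_linear A_def B_def X_def using dot_commute[of "{..<N}" ?m ?y]
        by (simp add: algebra_simps power2_eq_square)
      also have "\<dots> \<le> A + \<bar>t\<bar> * (A + B) + \<bar>t\<bar> * B"
      proof -
        have "t * (2 * X) \<le> \<bar>t\<bar> * (2 * \<bar>X\<bar>)"
          by (metis abs_ge_self abs_mult abs_numeral)
        also have "\<dots> \<le> \<bar>t\<bar> * (A + B)" by (intro mult_left_mono X) auto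
        finally have 1: "t * (2 * X) \<le> \<bar>t\<bar> * (A + B)" .
        have "t\<^sup>2 \<le> \<bar>t\<bar>" using mult_left_mono[OF t1(1), of "\<bar>t\<bar>"] by (simp add: power2_eq_square)
        then have "t\<^sup>2 * B \<le> \<bar>t\<bar> * B" by (intro mult_right_mono B)
        with 1 show ?thesis by simp
      qed
      also have "\<dots> = A + \<bar>t\<bar> * (A + 2 * B)" by (simp add: algebra_simps)
      also have "\<dots> \<le> c * n + \<bar>t\<bar> * (D * n)"
      proof (intro add_mono mult_left_mono A)
        have "c * n \<le> C\<^sup>2 * n" using c n by (intro mult_right_mono) auto
        then show "A + 2 * B \<le> D * n" using A B n unfolding D_def by (simp add: algebra_simps)
      qed auto
      also have "\<dots> = (c + \<bar>t\<bar> * D) * n" by (simp add: algebra_simps)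
      also have "\<dots> \<le> C\<^sup>2 * n" using t1 n by (intro mult_right_mono) auto
      finally show ?thesis by (simp add: n_def)
    qed
    finally show ?thesis by (simp add: top_p uu algebra_simps)
  qed
  then show ?thesis using \<delta> unfolding op_bound_def by blast
qed

section \<open>Partial coloring\<close>

lemma op_bound_closed:
  "closed {x::'l \<Rightarrow> real. op_bound N (lin_comb I (\<lambda>l. x l - x0 l) T) C}"
proof -
  have "{x::'l \<Rightarrow> real. op_bound N (lin_comb I (\<lambda>l. x l - x0 l) T) C} =
     (\<Inter>w. {x. dot {..<N} (mat_vec N (lin_comb I (\<lambda>l. x l - x0 l) T) w) (mat_vec N (lin_comb I (\<lambda>l. x l - x0 l) T) w)
        \<le> C\<^sup>2 * dot {..<N} w w})"
    by (auto simp: op_bound_def)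
  also have "closed \<dots>"
    unfolding mat_vec_lin_comb
    by (intro closed_INT ballI closed_Collect_le continuous_intros continuous_on_coordinate)
  finally show ?thesis .
qed

text \<open>
  Each of the \<open>r\<close> vectors satisfies \<open>\<parallel>M\<^sup>T M w\<parallel> = C\<^sup>2\<close>, and by Bessel their squares add up to at most
  \<open>\<parallel>M\<^sup>T M\<parallel>\<^sup>2\<close>.
\<close>

lemma top_singular_dimension:
  assumes orth: "orthonormal {..<N} w r" and top: "\<And>i. i < r \<Longrightarrow> top_singular N M C (w i)"
  shows "real r * C^4 \<le> schatten4 N M"
proof -
  let ?G = "mult_transposed N (transposed M) (transposed M)"
  have G: "dot {..<N} (?G a) u = mat_vec N (transposed M) (mat_vec N M u) a" for a u
    unfolding dot_def mult_transposed_def mat_vec_def transposed_def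
    by (simp add: sum_distrib_left sum_distrib_right algebra_simps) (rule sum.swap)
  have "real r * C^4 = (\<Sum>i<r. \<Sum>a<N. (dot {..<N} (?G a) (w i))\<^sup>2)"
  proof -
    have "(\<Sum>a<N. (dot {..<N} (?G a) (w i))\<^sup>2) = C^4" if i: "i < r" for i
    proof -
      let ?v = "mat_vec N (transposed M) (mat_vec N M (w i))"
      have v: "dot {..<N} ?v h = C\<^sup>2 * dot {..<N} (w i) h" for h
        using top[OF i] by (simp add: top_singular_def dot_mat_vec)
      have "(\<Sum>a<N. (dot {..<N} (?G a) (w i))\<^sup>2) = dot {..<N} ?v ?v"
        unfolding G by (simp add: dot_def power2_eq_square)
      also have "\<dots> = C\<^sup>2 * (C\<^sup>2 * dot {..<N} (w i) (w i))"
        by (simp only: v dot_commute[of _ "w i" ?v])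
      also have "\<dots> = C^4" using orth i by (simp add: orthonormal_def)
      finally show ?thesis .
    qed
    then show ?thesis by simp
  qed
  also have "\<dots> = (\<Sum>a<N. \<Sum>i<r. (dot {..<N} (w i) (?G a))\<^sup>2)"
    unfolding dot_commute[of _ "w _"] by (rule sum.swap)
  also have "\<dots> \<le> (\<Sum>a<N. dot {..<N} (?G a) (?G a))"
    by (intro sum_mono bessel orth)
  finally show ?thesis by (simp add: schatten4_def hs_sq_rows)
qed

text \<open>
  The last assumption is all that is used of the algebra: if \<open>w\<close> is an orthonormal basis of the space on
  which a combination \<open>M\<close> attains its norm, then twice as many linear equations as there are basis vectors
  make a combination \<open>Y\<close> satisfy the hypotheses of \<open>op_bound_perturb\<close>. For unstructured \<open>N \<times> N\<close>
  matrices about \<open>2 N\<close> equations per basis vector would be needed.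
\<close>

locale contraction_family =
  fixes N :: nat and L :: "'l set" and T :: "'l \<Rightarrow> nat \<Rightarrow> nat \<Rightarrow> real"
  assumes finite_L: "finite L"
    and contraction: "l \<in> L \<Longrightarrow> op_bound N (T l) 1"
    and freezing: "\<lbrakk>orthonormal {..<N} w r; \<And>i. i < r \<Longrightarrow> top_singular N (lin_comb L z T) C (w i);
      \<And>u. top_singular N (lin_comb L z T) C u \<Longrightarrow> \<forall>j\<in>{..<N}. u j = (\<Sum>i<r. dot {..<N} (w i) u * w i j)\<rbrakk> \<Longrightarrow>
      \<exists>c. \<forall>y. (\<forall>q<2*r. dot L (c q) y = 0) \<longrightarrow> (\<forall>i<r. \<forall>a<N.
        mat_vec N (lin_comb L y T) (w i) a = 0 \<and> mat_vec N (transposed (lin_comb L y T)) (mat_vec N (lin_comb L z T) (w i)) a = 0)"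
begin

lemma lin_comb_extend:
  assumes "I \<subseteq> L" "\<And>l. l \<in> L - I \<Longrightarrow> z l = 0"
  shows "lin_comb L z T = lin_comb I z T"
  unfolding lin_comb_def using assms finite_L
  by (intro ext sum.mono_neutral_right) auto

text \<open>
  The bound on the objective gives \<open>schatten4 \<le> k / \<mu>\<close> at the maximum \<open>x\<close>. Its two uses determine the
  constants: \<open>\<mu>\<close> is chosen so that the second-order conditions in the \<open>s > 3 k / 8\<close> available directions
  cannot all hold, and then \<open>C\<close> so that the top singular space has dimension at most \<open>k / 16\<close>, which
  keeps the number of equations at most \<open>k / 8\<close>.
\<close>

lemma partial_coloring:
  assumes I: "I \<subseteq> L" "I \<noteq> {}" and R: "real N \<le> R" "R > 0"
    and x0: "\<And>l. l \<in> I \<Longrightarrow> \<bar>x0 l\<bar> \<le> 1"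
  shows "\<exists>x. (\<forall>l\<in>I. \<bar>x l\<bar> \<le> 1) \<and> 2 * card {l\<in>I. \<bar>x l\<bar> < 1} \<le> card I \<and>
    op_bound N (lin_comb I (\<lambda>l. x l - x0 l) T) (8 * root 4 (R * real (card I)))"
proof -
  define k C \<mu> where "k = real (card I)" and "C = 8 * root 4 (R * k)" and "\<mu> = 1 / (256 * R * k)"
  have fI: "finite I" using I(1) finite_L by (rule finite_subset)
  have k: "k > 0" using I(2) fI by (simp add: k_def card_gt_0_iff)
  have C: "C > 0" using R k by (simp add: C_def)
  have C4: "C^4 = 4096 * (R * k)" using R k by (simp add: C_def power_mult_distrib real_root_pow_pos2)
  have \<mu>: "\<mu> > 0" using R k by (simp add: \<mu>_def)
  \<comment> \<open>Coordinates outside \<open>I\<close> are pinned to zero, so that the feasible set \<open>K\<close> is compact.\<close>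
  define x1 where "x1 = (\<lambda>l. if l \<in> I then x0 l else 0)"
  define S where "S = (\<lambda>x. lin_comb I (\<lambda>l. x l - x1 l) T)"
  define K where "K = PiE UNIV (\<lambda>l. if l \<in> I then {-1..1} else {0::real}) \<inter> {x. op_bound N (S x) C}"
  define F where "F = (\<lambda>x. (\<Sum>l\<in>I. (x l)\<^sup>2) - \<mu> * schatten4 N (S x))"
  have "compact K"
    unfolding K_def S_def by (intro compact_Int_closed compact_PiE_UNIV op_bound_closed) auto
  moreover have x1K: "x1 \<in> K"
    using x0 by (auto simp: K_def S_def x1_def abs_le_iff op_bound_def lin_comb_def mat_vec_def dot_def sum_nonneg)
  moreover have "continuous_on K F"
    unfolding F_def S_def schatten4_def hs_sq_def mult_transposed_def transposed_def lin_comb_def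
    by (intro continuous_intros continuous_on_coordinate)
  ultimately obtain x where x: "x \<in> K" and max: "\<And>y. y \<in> K \<Longrightarrow> F y \<le> F x"
    using continuous_attains_sup[of K F] by blast
  have x_mem: "x l \<in> (if l \<in> I then {-1..1} else {0})" for l
    using x unfolding K_def PiE_iff by blast
  have x_le: "\<bar>x l\<bar> \<le> 1" for l
    using x_mem[of l] by (auto split: if_splits)
  have x_out: "x l = 0" if "l \<notin> I" for l using x_mem[of l] that by simp
  have nl: "op_bound N (S x) C" using x by (simp add: K_def)
  have Sx1: "S x1 = (\<lambda>a b. 0)" by (simp add: S_def lin_comb_def)
  have schatten4_x: "\<mu> * schatten4 N (S x) \<le> k"
  proof -
    have "0 \<le> F x1"
      unfolding F_def Sx1 by (simp add: schatten4_def hs_sq_def mult_transposed_def transposed_def sum_nonneg)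
    also have "\<dots> \<le> F x" by (rule max[OF x1K])
    finally have "\<mu> * schatten4 N (S x) \<le> (\<Sum>l\<in>I. (x l)\<^sup>2)" by (simp add: F_def)
    also have "\<dots> \<le> (\<Sum>l\<in>I. 1)" using x_le by (intro sum_mono) (simp add: abs_square_le_1)
    finally show ?thesis by (simp add: k_def)
  qed
  define J where "J = {l\<in>I. \<bar>x l\<bar> < 1}"
  have J: "J \<subseteq> I" by (auto simp: J_def)
  have fJ: "finite J" using J fI finite_subset by blast
  have "2 * card J \<le> card I"
  proof (rule ccontr)
    assume "\<not> 2 * card J \<le> card I"
    then have Jk: "k < 2 * real (card J)" by (simp add: k_def)
    let ?z = "\<lambda>l. x l - x1 l"
    have SL: "S x = lin_comb L ?z T"
      unfolding S_def using I x_out by (intro lin_comb_extend[symmetric]) (auto simp: x1_def)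
    obtain w r where w: "orthonormal {..<N} w r" "\<And>i. i < r \<Longrightarrow> top_singular N (S x) C (w i)"
      "\<And>u. top_singular N (S x) C u \<Longrightarrow> \<forall>j\<in>{..<N}. u j = (\<Sum>i<r. dot {..<N} (w i) u * w i j)"
      by (rule maximal_orthonormal[of "{..<N}" "top_singular N (S x) C"])
         (auto simp: top_singular_def mat_vec_diff mat_vec_scale dot_linear algebra_simps mat_vec_def dot_def)
    have r: "16 * real r \<le> k"
    proof -
      have "real r * (4096 * (R * k)) \<le> schatten4 N (S x)" using top_singular_dimension[OF w(1,2)] C4 by simp
      also have "\<dots> \<le> k * (256 * R * k)"
        using schatten4_x R k by (simp add: \<mu>_def field_simps)
      finally have "(16 * real r) * (256 * (R * k)) \<le> k * (256 * (R * k))" by (simp add: algebra_simps)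
      then show ?thesis using R k by (simp add: mult_le_cancel_right)
    qed
    obtain c where c: "\<And>y i a. \<forall>q<2*r. dot L (c q) y = 0 \<Longrightarrow> i < r \<Longrightarrow> a < N \<Longrightarrow>
        mat_vec N (lin_comb L y T) (w i) a = 0 \<and> mat_vec N (transposed (lin_comb L y T)) (mat_vec N (S x) (w i)) a = 0"
      using freezing[of w r ?z C] w unfolding SL by blast
    define s where "s = card J - 2 * r"
    have s: "8 * real s > 3 * k" "s + 2 * r \<le> card J"
      using Jk r by (auto simp: s_def of_nat_diff)
    obtain y where y: "orthonormal J y s" "\<And>p l. p < s \<Longrightarrow> l \<notin> J \<Longrightarrow> y p l = 0"
        "\<And>p q. p < s \<Longrightarrow> q < 2*r \<Longrightarrow> dot J (c q) (y p) = 0"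
      using orthonormal_solutions[OF fJ s(2), of c] by blast
    have dot_ext: "dot X u (y p) = dot J u (y p)" if "p < s" "J \<subseteq> X" "X \<subseteq> L" for X u p
      unfolding dot_def using that y(2) finite_subset[OF that(3) finite_L]
      by (intro sum.mono_neutral_right) auto
    have yI: "orthonormal I y s"
      using y(1) dot_ext[of _ I] J I(1) by (simp add: orthonormal_def)
    define Y where "Y = (\<lambda>p. lin_comb I (y p) T)"
    have YL: "Y p = lin_comb L (y p) T" if "p < s" for p
      unfolding Y_def using I y(2)[OF that] J by (intro lin_comb_extend[symmetric]) auto
    define g where "g = (\<lambda>p. 2 * hs_sq N (mult_transposed N (S x) (Y p)) + 4 * hs_sq N (mult_transposed N (transposed (S x)) (transposed (Y p))))"
    \<comment> \<open>Otherwise moving from \<open>x\<close> by \<open>\<plusminus> t\<close> along \<open>y p\<close> would increase \<open>F\<close> on average.\<close>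
    have local_opt: "1 \<le> \<mu> * g p" if p: "p < s" for p
    proof (rule ccontr)
      assume neg: "\<not> 1 \<le> \<mu> * g p"
      have "dot L (c q) (y p) = 0" if "q < 2*r" for q
        using y(3)[OF p that] dot_ext[OF p, of L] J I(1) by auto
      then have "mat_vec N (Y p) (w i) a = 0 \<and> mat_vec N (transposed (Y p)) (mat_vec N (S x) (w i)) a = 0"
        if "i < r" "a < N" for i a using c[of "y p" i a] that unfolding YL[OF p] by blast
      then obtain \<delta> where \<delta>: "\<delta> > 0" "\<And>t. \<bar>t\<bar> \<le> \<delta> \<Longrightarrow> op_bound N (\<lambda>a b. S x a b + t * Y p a b) C"
        using op_bound_perturb[OF nl C w(1,2,3), of "Y p"] by blast
      have yy: "(\<Sum>l\<in>I. (y p l)\<^sup>2) = 1"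
        using yI p by (simp add: orthonormal_def dot_def power2_eq_square)
      have y_le: "\<bar>y p l\<bar> \<le> 1" if "l \<in> I" for l
        using member_le_sum[of l I "\<lambda>l. (y p l)\<^sup>2"] yy that fI by (simp add: abs_square_le_1)
      have "J \<noteq> {}" using Jk k by auto
      define m where "m = Min ((\<lambda>l. 1 - \<bar>x l\<bar>) ` J)"
      have m: "m > 0" "\<And>l. l \<in> J \<Longrightarrow> \<bar>x l\<bar> \<le> 1 - m"
      proof -
        show "m > 0" unfolding m_def using fJ \<open>J \<noteq> {}\<close> by (subst Min_gr_iff) (auto simp: J_def)
        show "\<bar>x l\<bar> \<le> 1 - m" if "l \<in> J" for l
        proof -
          have "m \<le> 1 - \<bar>x l\<bar>" unfolding m_def using fJ that by (intro Min_le) auto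
          then show ?thesis by simp
        qed
      qed
      define H where "H = schatten4 N (Y p)"
      have H: "0 \<le> H" by (simp add: H_def schatten4_def hs_sq_nonneg)
      define \<epsilon> where "\<epsilon> = (1 - \<mu> * g p) / (\<mu> * H + 1)"
      have \<epsilon>: "\<epsilon> > 0" using neg H \<mu> by (simp add: \<epsilon>_def add_nonneg_pos)
      \<comment> \<open>Small enough for the norm constraint (\<open>\<delta>\<close>), the cube (\<open>m\<close>) and the term of order \<open>t\<^sup>4\<close> (\<open>\<epsilon>\<close>).\<close>
      define t where "t = Min {1, \<delta>, m, \<epsilon> / 2}"
      have t: "t > 0" "t \<le> 1" "t \<le> \<delta>" "t \<le> m" "t < \<epsilon>" using \<delta>(1) m(1) \<epsilon> by (auto simp: t_def min_def)
      have inK: "(\<lambda>l. x l + u * y p l) \<in> K" if u: "\<bar>u\<bar> = t" for u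
      proof -
        have le: "\<bar>x l + u * y p l\<bar> \<le> 1" if "l \<in> I" for l
        proof (cases "l \<in> J")
          case True
          have "\<bar>u * y p l\<bar> \<le> t * 1" unfolding abs_mult u using y_le[OF that] t(1) by (intro mult_left_mono) auto
          then show ?thesis using m(2)[OF True] t(4) by linarith
        next
          case False
          then show ?thesis using y(2)[OF p False] x_le[of l] by simp
        qed
        have "x l + u * y p l \<in> {-1..1}" if "l \<in> I" for l
          using le[OF that] unfolding abs_le_iff atLeastAtMost_iff by linarith
        moreover have "x l + u * y p l = 0" if "l \<notin> I" for l
          using that J y(2)[OF p, of l] x_out by auto
        moreover have "S (\<lambda>l. x l + u * y p l) = (\<lambda>a b. S x a b + u * Y p a b)"
          unfolding S_def Y_def lin_comb_def by (simp add: algebra_simps sum.distrib sum_subtractf sum_distrib_left)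
        moreover have "op_bound N (\<lambda>a b. S x a b + u * Y p a b) C" using \<delta>(2)[of u] u t(3) by simp
        ultimately show ?thesis unfolding K_def by auto
      qed
      have Splus: "S (\<lambda>l. x l + u * y p l) = (\<lambda>a b. S x a b + u * Y p a b)" for u
        unfolding S_def Y_def lin_comb_def by (simp add: algebra_simps sum.distrib sum_subtractf sum_distrib_left)
      have "F (\<lambda>l. x l + t * y p l) + F (\<lambda>l. x l + (-t) * y p l) \<le> 2 * F x"
        using max[OF inK[of t]] max[OF inK[of "-t"]] t(1) by simp
      moreover have "(\<Sum>l\<in>I. (x l + t * y p l)\<^sup>2) + (\<Sum>l\<in>I. (x l + (-t) * y p l)\<^sup>2)
          = 2 * (\<Sum>l\<in>I. (x l)\<^sup>2) + 2 * t\<^sup>2 * (\<Sum>l\<in>I. (y p l)\<^sup>2)"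
        unfolding sum.distrib[symmetric] sum_distrib_left
        by (intro sum.cong refl) (simp add: power2_eq_square algebra_simps)
      ultimately have "2 * t\<^sup>2 \<le> \<mu> * (schatten4 N (\<lambda>a b. S x a b + t * Y p a b)
          + schatten4 N (\<lambda>a b. S x a b - t * Y p a b) - 2 * schatten4 N (S x))"
        unfolding F_def Splus yy by (simp add: algebra_simps)
      also have "\<dots> \<le> \<mu> * (2 * t\<^sup>2 * g p + 2 * t^4 * H)"
        using schatten4_second_difference[of N "S x" t "Y p"] \<mu>
        by (intro mult_left_mono) (simp_all add: g_def H_def)
      finally have "(2 * t\<^sup>2) * 1 \<le> (2 * t\<^sup>2) * (\<mu> * g p + t\<^sup>2 * (\<mu> * H))"
        by (simp add: algebra_simps power2_eq_square power4_eq_xxxx)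
      then have "1 \<le> \<mu> * g p + t\<^sup>2 * (\<mu> * H)" by (rule mult_left_le_imp_le) (use t(1) in simp)
      moreover have "t\<^sup>2 * (\<mu> * H) < 1 - \<mu> * g p"
      proof -
        have "t\<^sup>2 \<le> t" using t(1,2) by (simp add: power2_eq_square mult_left_le)
        then have "t\<^sup>2 * (\<mu> * H) \<le> t * (\<mu> * H + 1)"
          using \<mu> H t(1) by (intro mult_mono) auto
        also have "\<dots> < \<epsilon> * (\<mu> * H + 1)" using t(5) \<mu> H by (intro mult_strict_right_mono) (auto intro: add_nonneg_pos)
        also have "\<dots> = 1 - \<mu> * g p" using \<mu> H by (simp add: \<epsilon>_def add_nonneg_eq_0_iff)
        finally show ?thesis .
      qed
      ultimately show False by simp
    qed
    have "real s \<le> (\<Sum>p<s. \<mu> * g p)" using sum_mono[of "{..<s}" "\<lambda>_. 1" "\<lambda>p. \<mu> * g p"] local_opt by simp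
    also have "\<dots> = \<mu> * (2 * (\<Sum>p<s. hs_sq N (mult_transposed N (S x) (Y p))) + 4 * (\<Sum>p<s. hs_sq N (mult_transposed N (transposed (S x)) (transposed (Y p)))))"
      by (simp add: g_def sum_distrib_left sum.distrib algebra_simps)
    also have "\<dots> \<le> \<mu> * (2 * (k * hs_sq N (S x)) + 4 * (k * hs_sq N (transposed (S x))))"
      unfolding Y_def transposed_lin_comb k_def using contraction I(1) \<mu>
      by (intro mult_left_mono add_mono sum_hs_sq_mult_transposed_le yI fI) (auto intro: op_bound_transposed)
    also have "\<dots> = 6 * k * (\<mu> * hs_sq N (S x))" by (simp add: algebra_simps)
    finally have "real s \<le> k * (6 * (\<mu> * hs_sq N (S x)))" by (simp only: mult.assoc mult.left_commute)
    then have "k * 3 < k * (6 * (\<mu> * hs_sq N (S x))) * 8" using s(1) by linarith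
    then have "k * 3 < k * (48 * (\<mu> * hs_sq N (S x)))" by (simp only: mult_ac)
    then have "1 < 16 * (\<mu> * hs_sq N (S x))" using k by (simp only: mult_less_cancel_left_pos)
    then have "1\<^sup>2 < (16 * (\<mu> * hs_sq N (S x)))\<^sup>2" by (intro power_strict_mono) auto
    also have "\<dots> = 256 * \<mu>\<^sup>2 * (hs_sq N (S x))\<^sup>2" by (simp add: power_mult_distrib)
    also have "\<dots> \<le> 256 * \<mu>\<^sup>2 * (R * schatten4 N (S x))"
    proof (intro mult_left_mono)
      have "real N * schatten4 N (S x) \<le> R * schatten4 N (S x)"
        using R(1) by (intro mult_right_mono) (auto simp: schatten4_def hs_sq_nonneg)
      then show "(hs_sq N (S x))\<^sup>2 \<le> R * schatten4 N (S x)" using hs_sq_squared_le_schatten4[of N "S x"] by linarith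
    qed simp
    also have "\<dots> = 256 * \<mu> * R * (\<mu> * schatten4 N (S x))" by (simp add: power2_eq_square)
    also have "\<dots> \<le> 256 * \<mu> * R * k" using schatten4_x \<mu> R by (intro mult_left_mono) auto
    also have "\<dots> = 1" using R k by (simp add: \<mu>_def)
    finally show False by simp
  qed
  moreover have "S x = lin_comb I (\<lambda>l. x l - x0 l) T"
    unfolding S_def lin_comb_def by (intro ext sum.cong) (auto simp: x1_def)
  ultimately show ?thesis using x_le nl unfolding J_def C_def k_def by auto
qed

text \<open>
  The radii form a geometric series: \<open>1/2 \<le> (6/7)\<^sup>4\<close>, so halving the number of live coordinates multiplies the
  radius by at most \<open>6/7\<close>, and \<open>8 / (1 - 6/7) = 56\<close>.
\<close>

lemma full_coloring:
  assumes "I \<subseteq> L" and R: "real N \<le> R" "R > 0" and "\<And>l. l \<in> I \<Longrightarrow> \<bar>x0 l\<bar> \<le> 1"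
  shows "\<exists>x. (\<forall>l\<in>I. x l \<in> {-1, 1}) \<and>
    op_bound N (lin_comb I (\<lambda>l. x l - x0 l) T) (56 * root 4 (R * real (card I)))"
  using assms(1,4)
proof (induction "card I" arbitrary: I x0 rule: less_induct)
  case less
  show ?case
  proof (cases "I = {}")
    case True
    then show ?thesis by (auto simp: op_bound_def lin_comb_def mat_vec_def dot_def)
  next
    case False
    have fI: "finite I" using less.prems(1) finite_L by (rule finite_subset)
    let ?\<rho> = "\<lambda>I. root 4 (R * real (card I))"
    obtain x1 where x1: "\<forall>l\<in>I. \<bar>x1 l\<bar> \<le> 1" "2 * card {l\<in>I. \<bar>x1 l\<bar> < 1} \<le> card I"
        "op_bound N (lin_comb I (\<lambda>l. x1 l - x0 l) T) (8 * ?\<rho> I)"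
      using partial_coloring[OF less.prems(1) False R, of x0] less.prems(2) by blast
    define J where "J = {l\<in>I. \<bar>x1 l\<bar> < 1}"
    have J: "J \<subseteq> I" "J \<subseteq> L" using less.prems(1) by (auto simp: J_def)
    have "card I > 0" using False fI by (simp add: card_gt_0_iff)
    then have "card J < card I" using x1(2) by (simp add: J_def)
    then obtain x2 where x2: "\<forall>l\<in>J. x2 l \<in> {-1, 1}"
        "op_bound N (lin_comb J (\<lambda>l. x2 l - x1 l) T) (56 * ?\<rho> J)"
      using less.hyps[of J x1] J x1(1) by blast
    define x where "x = (\<lambda>l. if l \<in> J then x2 l else x1 l)"
    have "x l \<in> {-1, 1}" if "l \<in> I" for l
    proof (cases "l \<in> J")
      case True then show ?thesis using x2(1) by (simp add: x_def)
    next
      case False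
      then have "\<bar>x1 l\<bar> = 1" using that x1(1) by (auto simp: J_def)
      then show ?thesis using False by (auto simp: x_def abs_if split: if_splits)
    qed
    moreover have "op_bound N (lin_comb I (\<lambda>l. x l - x0 l) T) (56 * ?\<rho> I)"
    proof -
      have "lin_comb J (\<lambda>l. x2 l - x1 l) T = lin_comb I (\<lambda>l. x l - x1 l) T"
        unfolding lin_comb_def using J fI by (intro ext sum.mono_neutral_cong_left) (auto simp: x_def)
      then have "lin_comb I (\<lambda>l. x l - x0 l) T
          = (\<lambda>a b. lin_comb I (\<lambda>l. x1 l - x0 l) T a b + lin_comb J (\<lambda>l. x2 l - x1 l) T a b)"
        by (simp add: lin_comb_def algebra_simps flip: sum.distrib)
      moreover have "op_bound N (\<lambda>a b. lin_comb I (\<lambda>l. x1 l - x0 l) T a b + lin_comb J (\<lambda>l. x2 l - x1 l) T a b)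
          (8 * ?\<rho> I + 56 * ?\<rho> J)"
        using R by (intro op_bound_add x1(3) x2(2)) auto
      moreover have "8 * ?\<rho> I + 56 * ?\<rho> J \<le> 56 * ?\<rho> I"
      proof -
        have "R * real (card J) \<le> (6/7)^4 * (R * real (card I))"
        proof -
          have "2 * real (card J) \<le> real (card I)" using x1(2) by (simp add: J_def)
          then have "real (card J) \<le> (6/7)^4 * real (card I)" by (simp add: power_divide)
          then have "R * real (card J) \<le> R * ((6/7)^4 * real (card I))"
            using R by (intro mult_left_mono) auto
          then show ?thesis by (simp add: mult.left_commute)
        qed
        then have "?\<rho> J \<le> root 4 ((6/7)^4 * (R * real (card I)))" by simp
        also have "\<dots> = 6/7 * ?\<rho> I" by (subst real_root_mult) (simp add: real_root_power_cancel)
        finally show ?thesis by simp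
      qed
      ultimately show ?thesis using R by (auto intro: op_bound_mono)
    qed
    ultimately show ?thesis by blast
  qed
qed

end

section \<open>Complex matrices as a real Euclidean space\<close>

text \<open>The real part of \<open>tr (a\<^sup>* b)\<close>.\<close>

definition frob :: "nat \<Rightarrow> complex mat \<Rightarrow> complex mat \<Rightarrow> real" where
  "frob D a b = (\<Sum>i<D. \<Sum>j<D. Re (cnj (a $$ (i,j)) * b $$ (i,j)))"

lemma mat_adjoint_dim [simp]:
  "dim_row (mat_adjoint a) = dim_col a" "dim_col (mat_adjoint a) = dim_row a"
  by (simp_all add: mat_adjoint_def)

lemma mat_adjoint_closed [simp]:
  "a \<in> carrier_mat m n \<Longrightarrow> mat_adjoint a \<in> carrier_mat n m"
  by (intro carrier_matI) auto

lemma mat_adjoint_index [simp]: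
  "i < dim_col a \<Longrightarrow> j < dim_row a \<Longrightarrow> mat_adjoint a $$ (i,j) = cnj (a $$ (j,i))"
  by (simp add: mat_adjoint_def mat_of_rows_def)

lemma mult_mat_index_sum:
  "a \<in> carrier_mat D D \<Longrightarrow> b \<in> carrier_mat D D \<Longrightarrow> i < D \<Longrightarrow> j < D \<Longrightarrow>
   (a * b) $$ (i,j) = (\<Sum>k<D. a $$ (i,k) * b $$ (k,j))"
  by (simp add: scalar_prod_def lessThan_atLeast0)

lemma mat_adjoint_adjoint [simp]: "mat_adjoint (mat_adjoint a) = (a :: complex mat)"
  by (rule eq_matI) auto

lemma mat_adjoint_mult:
  assumes "a \<in> carrier_mat D D" "b \<in> carrier_mat D (D::nat)"
  shows "mat_adjoint (a * b) = mat_adjoint b * mat_adjoint (a :: complex mat)"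
proof (rule eq_matI)
  fix i j assume "i < dim_row (mat_adjoint b * mat_adjoint a)" "j < dim_col (mat_adjoint b * mat_adjoint a)"
  then have ij: "i < D" "j < D" using assms by auto
  have "mat_adjoint (a * b) $$ (i,j) = cnj ((a * b) $$ (j,i))" using assms ij by simp
  also have "\<dots> = (\<Sum>k<D. cnj (b $$ (k,i)) * cnj (a $$ (j,k)))"
    unfolding mult_mat_index_sum[OF assms ij(2,1)] by (simp add: mult.commute)
  also have "\<dots> = (mat_adjoint b * mat_adjoint a) $$ (i,j)"
    using assms ij by (subst mult_mat_index_sum[where D = D]) auto
  finally show "mat_adjoint (a * b) $$ (i,j) = (mat_adjoint b * mat_adjoint a) $$ (i,j)" .
qed (use assms in auto)

lemma frob_nonneg: "0 \<le> frob D a a"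
  unfolding frob_def by (intro sum_nonneg) (simp add: sum_squares_ge_zero)

lemma frob_commute: "frob D a b = frob D b a"
  unfolding frob_def by (intro sum.cong refl) simp

lemma frob_adjoint:
  "a \<in> carrier_mat D D \<Longrightarrow> b \<in> carrier_mat D D \<Longrightarrow> frob D (mat_adjoint a) (mat_adjoint b) = frob D a b"
  unfolding frob_def by (subst sum.swap, intro sum.cong refl) auto

lemma frob_mult_left:
  assumes "a \<in> carrier_mat D D" "b \<in> carrier_mat D D" "c \<in> carrier_mat D D"
  shows "frob D (a * b) c = frob D b (mat_adjoint a * c)"
proof -
  have "frob D (a * b) c = (\<Sum>i<D. \<Sum>j<D. \<Sum>k<D. Re (cnj (a $$ (i,k)) * cnj (b $$ (k,j)) * c $$ (i,j)))"
    unfolding frob_def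
    by (intro sum.cong refl)
       (simp only: lessThan_iff mult_mat_index_sum[OF assms(1,2)] cnj_sum complex_cnj_mult sum_distrib_right Re_sum)
  also have "\<dots> = (\<Sum>i<D. \<Sum>k<D. \<Sum>j<D. Re (cnj (a $$ (i,k)) * cnj (b $$ (k,j)) * c $$ (i,j)))"
    by (intro sum.cong refl sum.swap)
  also have "\<dots> = (\<Sum>k<D. \<Sum>i<D. \<Sum>j<D. Re (cnj (a $$ (i,k)) * cnj (b $$ (k,j)) * c $$ (i,j)))"
    by (rule sum.swap)
  also have "\<dots> = (\<Sum>k<D. \<Sum>j<D. \<Sum>i<D. Re (cnj (a $$ (i,k)) * cnj (b $$ (k,j)) * c $$ (i,j)))"
    by (intro sum.cong refl sum.swap)
  also have "\<dots> = frob D b (mat_adjoint a * c)"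
    unfolding frob_def
  proof (intro sum.cong refl)
    fix k j assume "k \<in> {..<D}" "j \<in> {..<D}"
    then have "(mat_adjoint a * c) $$ (k,j) = (\<Sum>i<D. cnj (a $$ (i,k)) * c $$ (i,j))"
      using assms by (subst mult_mat_index_sum[where D = D]) auto
    then show "(\<Sum>i<D. Re (cnj (a $$ (i,k)) * cnj (b $$ (k,j)) * c $$ (i,j)))
        = Re (cnj (b $$ (k,j)) * (mat_adjoint a * c) $$ (k,j))"
      by (simp only: sum_distrib_left Re_sum mult_ac)
  qed
  finally show ?thesis .
qed

lemma frob_mult_right:
  assumes "a \<in> carrier_mat D D" "b \<in> carrier_mat D D" "c \<in> carrier_mat D D"
  shows "frob D (a * b) c = frob D a (c * mat_adjoint b)"
proof -
  have "frob D (a * b) c = frob D (mat_adjoint b * mat_adjoint a) (mat_adjoint c)"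
    using assms by (simp add: frob_adjoint flip: mat_adjoint_mult)
  also have "\<dots> = frob D (mat_adjoint a) (b * mat_adjoint c)"
    using assms by (simp add: frob_mult_left)
  also have "\<dots> = frob D (mat_adjoint a) (mat_adjoint (c * mat_adjoint b))"
    using assms by (simp add: mat_adjoint_mult)
  also have "\<dots> = frob D a (c * mat_adjoint b)"
    using assms by (simp add: frob_adjoint)
  finally show ?thesis .
qed

text \<open>The flag selects the real (\<open>True\<close>) or the imaginary part of an entry.\<close>

definition entry_coords :: "nat \<Rightarrow> (nat \<times> nat \<times> bool) set" where
  "entry_coords D = {..<D} \<times> {..<D} \<times> UNIV"

definition vec_of :: "complex mat \<Rightarrow> nat \<times> nat \<times> bool \<Rightarrow> real" where
  "vec_of a = (\<lambda>(i,j,t). if t then Re (a $$ (i,j)) else Im (a $$ (i,j)))"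

definition mat_of :: "nat \<Rightarrow> (nat \<times> nat \<times> bool \<Rightarrow> real) \<Rightarrow> complex mat" where
  "mat_of D u = mat D D (\<lambda>(i,j). Complex (u (i,j,True)) (u (i,j,False)))"

lemma finite_entry_coords [simp]: "finite (entry_coords D)"
  by (simp add: entry_coords_def)

lemma mat_of_carrier [simp]: "mat_of D u \<in> carrier_mat D D"
  by (simp add: mat_of_def)

lemma mat_of_vec_of: "a \<in> carrier_mat D D \<Longrightarrow> mat_of D (vec_of a) = a"
  by (rule eq_matI) (auto simp: mat_of_def vec_of_def)

lemma vec_of_mat_of: "p \<in> entry_coords D \<Longrightarrow> vec_of (mat_of D u) p = u p"
  by (cases p) (auto simp: mat_of_def vec_of_def entry_coords_def)

lemma sum_entry_coords: "(\<Sum>p\<in>entry_coords D. f p) = (\<Sum>i<D. \<Sum>j<D. f (i,j,True) + f (i,j,False))"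
proof -
  have "(\<Sum>p\<in>entry_coords D. f p) = (\<Sum>i<D. \<Sum>j<D. \<Sum>t\<in>UNIV. f (i,j,t))"
    by (simp add: entry_coords_def sum.cartesian_product split_def)
  then show ?thesis by (simp add: UNIV_bool add.commute)
qed

lemma dot_vec_of: "dot (entry_coords D) (vec_of a) (vec_of b) = frob D a b"
  unfolding dot_def frob_def sum_entry_coords by (intro sum.cong refl) (simp add: vec_of_def)

lemma dot_mat_of: "dot (entry_coords D) u v = frob D (mat_of D u) (mat_of D v)"
  unfolding dot_vec_of[symmetric] by (rule dot_cong) (simp_all add: vec_of_mat_of)

lemma mat_of_scale: "mat_of D (\<lambda>p. c * u p) = complex_of_real c \<cdot>\<^sub>m mat_of D u"
  by (rule eq_matI) (auto simp: mat_of_def complex_eq_iff)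

lemma mat_of_diff: "mat_of D (\<lambda>p. u p - v p) = mat_of D u + (- 1) \<cdot>\<^sub>m mat_of D v"
  by (rule eq_matI) (auto simp: mat_of_def complex_eq_iff)

lemma mat_of_0: "mat_of D (\<lambda>p. 0) = 0\<^sub>m D D"
  by (rule eq_matI) (auto simp: mat_of_def complex_eq_iff)

lemma mat_of_index_sum:
  "p < D \<Longrightarrow> q < D \<Longrightarrow> mat_of D (\<lambda>x. \<Sum>i\<in>I. c i * w i x) $$ (p,q) = (\<Sum>i\<in>I. complex_of_real (c i) * mat_of D (w i) $$ (p,q))"
  by (auto simp: mat_of_def complex_eq_iff)

lemma frob_eq_0: 
  assumes "a \<in> carrier_mat D D" "frob D a a = 0"
  shows "a = 0\<^sub>m D D"
proof -
  have "\<forall>p\<in>entry_coords D. vec_of a p = 0"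
    using assms(2) dot_self_eq_0[OF finite_entry_coords] by (simp flip: dot_vec_of)
  then have "mat_of D (vec_of a) = mat_of D (\<lambda>p. 0)"
    by (intro eq_matI) (auto simp: mat_of_def entry_coords_def)
  then show ?thesis using assms(1) by (simp add: mat_of_vec_of mat_of_0)
qed

lemma frob_Cauchy_Schwarz: "(frob D a b)\<^sup>2 \<le> frob D a a * frob D b b"
  unfolding dot_vec_of[symmetric] by (rule dot_Cauchy_Schwarz)

lemma frob_self: "frob D a a = (\<Sum>i<D. \<Sum>j<D. (cmod (a $$ (i,j)))\<^sup>2)"
  unfolding frob_def by (intro sum.cong refl) (simp only: cmod_power2, simp add: power2_eq_square)

lemma frob_submultiplicative:
  assumes "a \<in> carrier_mat D D" "b \<in> carrier_mat D D"
  shows "frob D (a * b) (a * b) \<le> frob D a a * frob D b b"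
proof -
  have "(cmod ((a * b) $$ (i,j)))\<^sup>2 \<le> (\<Sum>k<D. (cmod (a $$ (i,k)))\<^sup>2) * (\<Sum>k<D. (cmod (b $$ (k,j)))\<^sup>2)"
    if "i < D" "j < D" for i j
  proof -
    have "cmod ((a * b) $$ (i,j)) \<le> (\<Sum>k<D. cmod (a $$ (i,k)) * cmod (b $$ (k,j)))"
      unfolding mult_mat_index_sum[OF assms that] norm_mult[symmetric] by (rule norm_sum)
    then have "(cmod ((a * b) $$ (i,j)))\<^sup>2 \<le> (\<Sum>k<D. cmod (a $$ (i,k)) * cmod (b $$ (k,j)))\<^sup>2"
      by (rule power_mono) simp
    also have "\<dots> \<le> (\<Sum>k<D. (cmod (a $$ (i,k)))\<^sup>2) * (\<Sum>k<D. (cmod (b $$ (k,j)))\<^sup>2)"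
      by (rule Cauchy_Schwarz_ineq_sum)
    finally show ?thesis .
  qed
  then have "frob D (a * b) (a * b)
      \<le> (\<Sum>i<D. \<Sum>j<D. (\<Sum>k<D. (cmod (a $$ (i,k)))\<^sup>2) * (\<Sum>k<D. (cmod (b $$ (k,j)))\<^sup>2))"
    unfolding frob_self by (intro sum_mono) simp
  also have "\<dots> = frob D a a * (\<Sum>j<D. \<Sum>k<D. (cmod (b $$ (k,j)))\<^sup>2)"
    unfolding frob_self by (rule sum_product[symmetric])
  also have "(\<Sum>j<D. \<Sum>k<D. (cmod (b $$ (k,j)))\<^sup>2) = frob D b b"
    unfolding frob_self by (rule sum.swap)
  finally show ?thesis .
qed

definition mat_comb :: "nat \<Rightarrow> 'l set \<Rightarrow> ('l \<Rightarrow> real) \<Rightarrow> ('l \<Rightarrow> complex mat) \<Rightarrow> complex mat" where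
  "mat_comb D L z A = mat D D (\<lambda>(i,j). \<Sum>l\<in>L. complex_of_real (z l) * A l $$ (i,j))"

lemma mat_comb_carrier [simp]: "mat_comb D L z A \<in> carrier_mat D D"
  by (simp add: mat_comb_def)

lemma frob_mat_comb_mult:
  assumes A: "\<And>l. l \<in> L \<Longrightarrow> A l \<in> carrier_mat D D" and W: "W \<in> carrier_mat D D"
  shows "frob D a (mat_comb D L z A * W) = (\<Sum>l\<in>L. z l * frob D a (A l * W))"
proof -
  have e: "(mat_comb D L z A * W) $$ (i,j) = (\<Sum>l\<in>L. complex_of_real (z l) * (A l * W) $$ (i,j))"
    if "i < D" "j < D" for i j
  proof -
    have "(mat_comb D L z A * W) $$ (i,j) = (\<Sum>k<D. \<Sum>l\<in>L. complex_of_real (z l) * A l $$ (i,k) * W $$ (k,j))"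
      using that W by (simp add: mult_mat_index_sum[where D = D]) (simp add: mat_comb_def sum_distrib_right)
    also have "\<dots> = (\<Sum>l\<in>L. \<Sum>k<D. complex_of_real (z l) * A l $$ (i,k) * W $$ (k,j))"
      by (rule sum.swap)
    also have "\<dots> = (\<Sum>l\<in>L. complex_of_real (z l) * (A l * W) $$ (i,j))"
      by (rule sum.cong) (use that W A in \<open>auto simp: mult_mat_index_sum[where D = D] sum_distrib_left mult.assoc\<close>)
    finally show ?thesis .
  qed
  have "frob D a (mat_comb D L z A * W)
      = (\<Sum>i<D. \<Sum>j<D. \<Sum>l\<in>L. z l * Re (cnj (a $$ (i,j)) * (A l * W) $$ (i,j)))"
    unfolding frob_def
    by (intro sum.cong refl) (auto simp: e sum_distrib_left algebra_simps sum_subtractf sum.distrib)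
  also have "\<dots> = (\<Sum>i<D. \<Sum>l\<in>L. \<Sum>j<D. z l * Re (cnj (a $$ (i,j)) * (A l * W) $$ (i,j)))"
    by (intro sum.cong refl sum.swap)
  also have "\<dots> = (\<Sum>l\<in>L. \<Sum>i<D. \<Sum>j<D. z l * Re (cnj (a $$ (i,j)) * (A l * W) $$ (i,j)))"
    by (rule sum.swap)
  finally show ?thesis unfolding frob_def by (simp only: sum_distrib_left)
qed

lemma frob_mat_comb:
  assumes "\<And>l. l \<in> L \<Longrightarrow> A l \<in> carrier_mat D D"
  shows "frob D a (mat_comb D L z A) = (\<Sum>l\<in>L. z l * frob D a (A l))"
  using frob_mat_comb_mult[of L A D "1\<^sub>m D" a z] assms by (simp add: right_mult_one_mat[of _ D D])

lemma star_subalgebraD: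
  assumes "star_subalgebra D \<A>"
  shows "\<A> \<subseteq> carrier_mat D D"
    and "a \<in> \<A> \<Longrightarrow> b \<in> \<A> \<Longrightarrow> a + b \<in> \<A>"
    and "a \<in> \<A> \<Longrightarrow> c \<cdot>\<^sub>m a \<in> \<A>"
    and "0\<^sub>m D D \<in> \<A>"
    and "a \<in> \<A> \<Longrightarrow> b \<in> \<A> \<Longrightarrow> a * b \<in> \<A>"
    and "a \<in> \<A> \<Longrightarrow> mat_adjoint a \<in> \<A>"
    and "vectorspace class_ring ((op_space D)\<lparr>carrier := \<A>\<rparr>)"
proof -
  have vs: "vectorspace class_ring (op_space D)" and sm: "submodule class_ring \<A> (op_space D)"
    using assms by (auto simp: star_subalgebra_def VectorSpace.subspace_def)
  show "\<A> \<subseteq> carrier_mat D D" "a \<in> \<A> \<Longrightarrow> b \<in> \<A> \<Longrightarrow> a + b \<in> \<A>"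
    "a \<in> \<A> \<Longrightarrow> c \<cdot>\<^sub>m a \<in> \<A>" "0\<^sub>m D D \<in> \<A>"
    using submodule.subset[OF sm] submodule.m_closed[OF sm] submodule.smult_closed[OF sm] submodule.zero_closed[OF sm]
    by (auto simp: module_mat_simps class_ring_simps)
  show "a \<in> \<A> \<Longrightarrow> b \<in> \<A> \<Longrightarrow> a * b \<in> \<A>" "a \<in> \<A> \<Longrightarrow> mat_adjoint a \<in> \<A>"
    using assms by (auto simp: star_subalgebra_def)
  show "vectorspace class_ring ((op_space D)\<lparr>carrier := \<A>\<rparr>)"
    using vs assms by (intro vectorspace.subspace_is_vs) (auto simp: star_subalgebra_def)
qed

text \<open>
  Stated for any module of matrices, because both the full matrix space and the algebra as a space of its own are needed.
\<close>

lemma finsum_entries: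
  assumes M: "abelian_group M" "add M = (+)" "zero M = 0\<^sub>m D D" "carrier M \<subseteq> carrier_mat D D"
    and "finite B" "\<And>b. b \<in> B \<Longrightarrow> f b \<in> carrier M" "p < D" "q < D"
  shows "(\<Oplus>\<^bsub>M\<^esub>b\<in>B. f b) $$ (p,q) = (\<Sum>b\<in>B. (f b :: complex mat) $$ (p,q))"
proof -
  interpret abelian_group M by fact
  show ?thesis
    using assms(5,6)
  proof (induction B rule: finite_induct)
    case empty
    show ?case using assms(7,8) by (simp only: finsum_empty M(3) index_zero_mat sum.empty)
  next
    case (insert b B)
    have "(\<Oplus>\<^bsub>M\<^esub>b\<in>B. f b) \<in> carrier M" using insert by (intro finsum_closed) auto
    moreover have "finsum M f (insert b B) = f b + finsum M f B"
      using insert by (subst finsum_insert) (auto simp: M(2))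
    moreover have "f b \<in> carrier_mat D D" using insert.prems M(4) by auto
    moreover have "finsum M f B \<in> carrier_mat D D"
      using insert.prems M(4) finsum_closed[of f B] by auto
    ultimately show ?case using insert assms(7,8) by simp
  qed
qed

section \<open>The regular representation of a *-subalgebra\<close>

text \<open>
  The family \<open>f\<close> is a real orthonormal basis of the algebra, so \<open>N\<close> is its real dimension. Real coordinates
  are used because the signs are real.
\<close>

locale matrix_algebra =
  fixes D :: nat and \<A> :: "complex mat set" and N :: nat and f :: "nat \<Rightarrow> complex mat"
  assumes star: "star_subalgebra D \<A>"
    and f_mem: "i < N \<Longrightarrow> f i \<in> \<A>"
    and f_on: "i < N \<Longrightarrow> j < N \<Longrightarrow> frob D (f i) (f j) = (if i = j then 1 else 0)"
    and f_span: "a \<in> \<A> \<Longrightarrow> mat_comb D {..<N} (\<lambda>i. frob D (f i) a) f = a"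

lemma mat_comb_mem:
  assumes "star_subalgebra D \<A>" "finite L" "\<And>l. l \<in> L \<Longrightarrow> A l \<in> \<A>"
  shows "mat_comb D L z A \<in> \<A>"
  using assms(2,3)
proof (induction L rule: finite_induct)
  case empty
  have "mat_comb D {} z A = 0\<^sub>m D D" by (rule eq_matI) (auto simp: mat_comb_def)
  then show ?case using star_subalgebraD(4)[OF assms(1)] by simp
next
  case (insert l L)
  have "A l \<in> carrier_mat D D" using insert star_subalgebraD(1)[OF assms(1)] by auto
  then have "mat_comb D (insert l L) z A = complex_of_real (z l) \<cdot>\<^sub>m A l + mat_comb D L z A"
    using insert by (intro eq_matI) (auto simp: mat_comb_def)
  then show ?case using insert star_subalgebraD(2,3)[OF assms(1)] by auto
qed

lemma (in matrix_algebra) carrierD: "a \<in> \<A> \<Longrightarrow> a \<in> carrier_mat D D"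
  using star_subalgebraD(1)[OF star] by blast

lemma (in matrix_algebra) mult_mem: "a \<in> \<A> \<Longrightarrow> b \<in> \<A> \<Longrightarrow> a * b \<in> \<A>"
  using star_subalgebraD(5)[OF star] by blast

lemma (in matrix_algebra) adjoint_mem: "a \<in> \<A> \<Longrightarrow> mat_adjoint a \<in> \<A>"
  using star_subalgebraD(6)[OF star] by blast

context matrix_algebra
begin

abbreviation of_coords :: "(nat \<Rightarrow> real) \<Rightarrow> complex mat" where
  "of_coords c \<equiv> mat_comb D {..<N} c f"

text \<open>The real matrix of left multiplication by \<open>a\<close> on the algebra, in the basis \<open>f\<close>.\<close>

definition regular :: "complex mat \<Rightarrow> nat \<Rightarrow> nat \<Rightarrow> real" where
  "regular a = (\<lambda>i j. frob D (f i) (a * f j))"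

lemma of_coords_mem [simp]: "of_coords c \<in> \<A>"
  using f_mem by (intro mat_comb_mem[OF star]) auto

lemma frob_of_coords_right: "frob D a (of_coords c) = (\<Sum>i<N. c i * frob D a (f i))"
  using f_mem carrierD by (intro frob_mat_comb) auto

lemma frob_expand: "a \<in> \<A> \<Longrightarrow> frob D b a = (\<Sum>i<N. frob D (f i) a * frob D b (f i))"
  using frob_of_coords_right[of b "\<lambda>i. frob D (f i) a"] by (simp add: f_span)

lemma frob_basis_of_coords: "i < N \<Longrightarrow> frob D (f i) (of_coords c) = c i"
  unfolding frob_of_coords_right by (simp add: f_on if_distrib cong: if_cong)

lemma frob_of_coords: "frob D (of_coords c) (of_coords d) = dot {..<N} c d"
  unfolding frob_of_coords_right[of "of_coords c"] dot_def
  by (intro sum.cong refl) (simp add: frob_commute[of D "of_coords c"] frob_basis_of_coords)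

lemma mat_vec_regular:
  assumes "a \<in> carrier_mat D D" "i < N"
  shows "mat_vec N (regular a) c i = frob D (f i) (a * of_coords c)"
proof -
  have fi: "f i \<in> carrier_mat D D" "\<And>j. j < N \<Longrightarrow> f j \<in> carrier_mat D D" using f_mem assms(2) carrierD by auto
  have "frob D (f i) (a * of_coords c) = frob D (mat_adjoint a * f i) (of_coords c)"
    using assms fi frob_mult_left[of "mat_adjoint a" D "f i" "of_coords c"] by simp
  also have "\<dots> = (\<Sum>j<N. c j * frob D (f i) (a * f j))"
    unfolding frob_of_coords_right
    using assms fi frob_mult_left[of "mat_adjoint a" D "f i"] by (intro sum.cong refl) simp
  finally show ?thesis by (simp add: mat_vec_def regular_def mult.commute)
qed

lemma lin_comb_regular:
  assumes "\<And>l. l \<in> L \<Longrightarrow> A l \<in> \<A>" "j < N"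
  shows "lin_comb L z (\<lambda>l. regular (A l)) i j = regular (mat_comb D L z A) i j"
  unfolding lin_comb_def regular_def using assms f_mem carrierD by (subst frob_mat_comb_mult) auto

lemma mat_vec_lin_comb_regular:
  assumes "\<And>l. l \<in> L \<Longrightarrow> A l \<in> \<A>"
  shows "mat_vec N (lin_comb L z (\<lambda>l. regular (A l))) c = mat_vec N (regular (mat_comb D L z A)) c"
  unfolding mat_vec_def using lin_comb_regular[of L A _ z] assms by simp

lemma dot_mat_vec_regular:
  assumes "a \<in> \<A>"
  shows "dot {..<N} (mat_vec N (regular a) c) (mat_vec N (regular a) d) = frob D (a * of_coords c) (a * of_coords d)"
proof -
  have "frob D (a * of_coords c) (a * of_coords d) = (\<Sum>i<N. frob D (f i) (a * of_coords d) * frob D (a * of_coords c) (f i))"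
    using assms by (intro frob_expand mult_mem) auto
  also have "\<dots> = dot {..<N} (mat_vec N (regular a) c) (mat_vec N (regular a) d)"
    unfolding dot_def using mat_vec_regular[OF carrierD[OF assms]]
    by (intro sum.cong refl) (simp add: frob_commute[of D "a * of_coords c"])
  finally show ?thesis by simp
qed

lemma op_bound_regular_iff:
  assumes "a \<in> \<A>"
  shows "op_bound N (regular a) C \<longleftrightarrow> (\<forall>W\<in>\<A>. frob D (a * W) (a * W) \<le> C\<^sup>2 * frob D W W)"
proof
  assume nl: "op_bound N (regular a) C"
  show "\<forall>W\<in>\<A>. frob D (a * W) (a * W) \<le> C\<^sup>2 * frob D W W"
  proof
    fix W assume "W \<in> \<A>"
    then have W: "of_coords (\<lambda>i. frob D (f i) W) = W" by (rule f_span)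
    show "frob D (a * W) (a * W) \<le> C\<^sup>2 * frob D W W"
      using nl[unfolded op_bound_def, rule_format, of "\<lambda>i. frob D (f i) W"]
      unfolding dot_mat_vec_regular[OF assms] unfolding frob_of_coords[symmetric] W .
  qed
next
  assume "\<forall>W\<in>\<A>. frob D (a * W) (a * W) \<le> C\<^sup>2 * frob D W W"
  then show "op_bound N (regular a) C"
    unfolding op_bound_def dot_mat_vec_regular[OF assms] unfolding frob_of_coords[symmetric] by simp
qed

lemma top_singular_regular_iff:
  assumes "a \<in> \<A>"
  shows "top_singular N (regular a) C c \<longleftrightarrow>
    (\<forall>Z\<in>\<A>. frob D (a * of_coords c) (a * Z) = C\<^sup>2 * frob D (of_coords c) Z)"
proof
  assume top: "top_singular N (regular a) C c"
  show "\<forall>Z\<in>\<A>. frob D (a * of_coords c) (a * Z) = C\<^sup>2 * frob D (of_coords c) Z"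
  proof
    fix Z assume "Z \<in> \<A>"
    then have Z: "of_coords (\<lambda>i. frob D (f i) Z) = Z" by (rule f_span)
    show "frob D (a * of_coords c) (a * Z) = C\<^sup>2 * frob D (of_coords c) Z"
      using top[unfolded top_singular_def, rule_format, of "\<lambda>i. frob D (f i) Z"]
      unfolding dot_mat_vec_regular[OF assms] unfolding frob_of_coords[symmetric] Z .
  qed
next
  assume "\<forall>Z\<in>\<A>. frob D (a * of_coords c) (a * Z) = C\<^sup>2 * frob D (of_coords c) Z"
  then show "top_singular N (regular a) C c"
    unfolding top_singular_def dot_mat_vec_regular[OF assms] unfolding frob_of_coords[symmetric] by simp
qed

text \<open>
  Left multiplication by \<open>a\<close> commutes with right multiplications, and right multiplication by \<open>X\<close> has
  adjoint right multiplication by \<open>X\<^sup>*\<close>.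
\<close>

lemma top_singular_right_ideal:
  assumes a: "a \<in> \<A>" and X: "X \<in> \<A>" and top: "top_singular N (regular a) C c"
  shows "top_singular N (regular a) C (\<lambda>i. frob D (f i) (of_coords c * X))"
  unfolding top_singular_regular_iff[OF a]
proof
  fix Z assume Z: "Z \<in> \<A>"
  have W: "of_coords (\<lambda>i. frob D (f i) (of_coords c * X)) = of_coords c * X"
    using X by (intro f_span mult_mem) auto
  note car = carrierD[OF a] carrierD[OF X] carrierD[OF Z]
  have ZX: "Z * mat_adjoint X \<in> \<A>" using X Z by (intro mult_mem adjoint_mem)
  have "frob D (a * (of_coords c * X)) (a * Z) = frob D (a * of_coords c * X) (a * Z)"
    using car by (simp add: assoc_mult_mat[of _ D D _ D _ D])
  also have "\<dots> = frob D (a * of_coords c) (a * Z * mat_adjoint X)"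
    using car by (intro frob_mult_right) auto
  also have "\<dots> = frob D (a * of_coords c) (a * (Z * mat_adjoint X))"
    using car by (simp add: assoc_mult_mat[of _ D D _ D _ D])
  also have "\<dots> = C\<^sup>2 * frob D (of_coords c) (Z * mat_adjoint X)"
    using top ZX unfolding top_singular_regular_iff[OF a] by blast
  also have "\<dots> = C\<^sup>2 * frob D (of_coords c * X) Z"
    using car by (simp add: frob_mult_right)
  finally show "frob D (a * of_coords (\<lambda>i. frob D (f i) (of_coords c * X))) (a * Z)
      = C\<^sup>2 * frob D (of_coords (\<lambda>i. frob D (f i) (of_coords c * X))) Z"
    unfolding W .
qed

text \<open>
  This is where the number of equations drops. With \<open>W\<close> in the right ideal \<open>E\<close> of top singular vectors and \<open>Q = Y W\<close>,
  cyclicity of the trace gives \<open>\<parallel>Y W\<parallel>\<^sup>2 = \<langle>Y, Q W\<^sup>*\<rangle> = \<langle>(W Q\<^sup>*)\<^sup>*, Y\<rangle>\<close>, and \<open>W Q\<^sup>*\<close> lies again in \<open>E\<close>. So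
  orthogonality to the vectors of \<open>E\<close> already forces \<open>Y W\<close> to vanish. The same computation with \<open>P = Y\<^sup>* S W\<close>
  gives the second equation.
\<close>

lemma orthogonal_to_ideal_annihilates:
  assumes S: "S \<in> \<A>" and Y: "Y \<in> \<A>" and top: "top_singular N (regular S) C c"
    and 1: "\<And>d. top_singular N (regular S) C d \<Longrightarrow> frob D (mat_adjoint (of_coords d)) Y = 0"
    and 2: "\<And>d. top_singular N (regular S) C d \<Longrightarrow> frob D (S * of_coords d) Y = 0"
  shows "Y * of_coords c = 0\<^sub>m D D" "mat_adjoint Y * (S * of_coords c) = 0\<^sub>m D D"
proof -
  let ?W = "of_coords c"
  have W: "?W \<in> \<A>" by simp
  have el: "of_coords (\<lambda>i. frob D (f i) (?W * X)) = ?W * X" if "X \<in> \<A>" for X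
    using that by (intro f_span mult_mem) auto
  note car = carrierD[OF S] carrierD[OF Y] carrierD[OF W]
  define Q where "Q = Y * ?W"
  have Q: "mat_adjoint Q \<in> \<A>" unfolding Q_def using Y by (intro adjoint_mem mult_mem) auto
  have Qc: "Q \<in> carrier_mat D D" using car by (simp add: Q_def)
  have "frob D Q Q = frob D Y (Q * mat_adjoint ?W)"
    using Qc car unfolding Q_def by (intro frob_mult_right) auto
  also have "\<dots> = frob D (mat_adjoint (?W * mat_adjoint Q)) Y"
    using Qc car by (simp add: mat_adjoint_mult[of _ D] frob_commute)
  also have "\<dots> = 0"
    using 1[OF top_singular_right_ideal[OF S Q top]] el[OF Q] by simp
  finally show "Y * ?W = 0\<^sub>m D D" using frob_eq_0[OF Qc] by (simp add: Q_def)
  define P where "P = mat_adjoint Y * (S * ?W)"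
  have P: "mat_adjoint P \<in> \<A>"
    unfolding P_def using Y S by (intro adjoint_mem mult_mem) auto
  have Pc: "P \<in> carrier_mat D D" using car unfolding P_def by (intro mult_carrier_mat[of _ D D]) auto
  have "frob D P P = frob D (S * ?W) (Y * P)"
    using Pc car frob_mult_left[of "mat_adjoint Y" D "S * ?W" P] by (simp add: P_def)
  also have "\<dots> = frob D (Y * P) (S * ?W)" by (rule frob_commute)
  also have "\<dots> = frob D Y (S * ?W * mat_adjoint P)"
    using Pc car by (intro frob_mult_right) auto
  also have "\<dots> = frob D (S * (?W * mat_adjoint P)) Y"
    using Pc car by (simp add: frob_commute[of D Y] assoc_mult_mat[of _ D D _ D _ D])
  also have "\<dots> = 0"
    using 2[OF top_singular_right_ideal[OF S P top]] el[OF P] by simp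
  finally show "mat_adjoint Y * (S * ?W) = 0\<^sub>m D D" using frob_eq_0[OF Pc] by (simp add: P_def)
qed

lemma frob_zero_right [simp]: "frob D a (0\<^sub>m D D) = 0"
  by (simp add: frob_def)

lemma regular_contraction_family:
  assumes L: "finite L" and A: "\<And>l. l \<in> L \<Longrightarrow> A l \<in> \<A>"
    and contr: "\<And>l W. l \<in> L \<Longrightarrow> W \<in> \<A> \<Longrightarrow> frob D (A l * W) (A l * W) \<le> frob D W W"
  shows "contraction_family N L (\<lambda>l. regular (A l))"
proof
  show "finite L" by fact
  show "op_bound N (regular (A l)) 1" if "l \<in> L" for l
    unfolding op_bound_regular_iff[OF A[OF that]] using contr that by simp
next
  fix w :: "nat \<Rightarrow> nat \<Rightarrow> real" and r z C
  let ?T = "\<lambda>l. regular (A l)"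
  define S where "S = mat_comb D L z A"
  have S: "S \<in> \<A>" unfolding S_def by (rule mat_comb_mem[of D \<A> L A, OF star L A])
  have Sc: "S \<in> carrier_mat D D" by (rule carrierD[OF S])
  have mvc: "mat_vec N (lin_comb L v ?T) c = mat_vec N (regular (mat_comb D L v A)) c" for v c
    by (rule mat_vec_lin_comb_regular) (rule A)
  have mvz: "mat_vec N (lin_comb L z ?T) c = mat_vec N (regular S) c" for c
    unfolding S_def by (rule mvc)
  have top_eq: "top_singular N (lin_comb L z ?T) C c = top_singular N (regular S) C c" for c
    unfolding top_singular_def mvz ..
  assume top: "\<And>i. i < r \<Longrightarrow> top_singular N (lin_comb L z ?T) C (w i)"
    and span: "\<And>u. top_singular N (lin_comb L z ?T) C u \<Longrightarrow>
        \<forall>j\<in>{..<N}. u j = (\<Sum>i<r. dot {..<N} (w i) u * w i j)"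
  \<comment> \<open>Two functionals per basis vector: even indices for \<open>Y E = 0\<close>, odd ones for \<open>Y\<^sup>* S E = 0\<close>.\<close>
  define c where "c = (\<lambda>q l. if even q then frob D (mat_adjoint (of_coords (w (q div 2)))) (A l)
      else frob D (S * of_coords (w (q div 2))) (A l))"
  show "\<exists>c. \<forall>y. (\<forall>q<2*r. dot L (c q) y = 0) \<longrightarrow> (\<forall>i<r. \<forall>a<N.
        mat_vec N (lin_comb L y ?T) (w i) a = 0 \<and> mat_vec N (transposed (lin_comb L y ?T)) (mat_vec N (lin_comb L z ?T) (w i)) a = 0)"
  proof (rule exI[of _ c], intro allI impI)
    fix y i a
    assume q: "\<forall>q<2*r. dot L (c q) y = 0" and i: "i < r" and a: "a < N"
    define Y where "Y = mat_comb D L y A"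
    have Y: "Y \<in> \<A>" unfolding Y_def by (rule mat_comb_mem[of D \<A> L A, OF star L A])
    have Yc: "Y \<in> carrier_mat D D" by (rule carrierD[OF Y])
    have fc: "\<And>j. j < N \<Longrightarrow> f j \<in> carrier_mat D D" using f_mem carrierD by auto
    have fipY: "frob D X Y = (\<Sum>l\<in>L. y l * frob D X (A l))" for X
      unfolding Y_def using A carrierD by (intro frob_mat_comb) auto
    have c1: "frob D (mat_adjoint (of_coords (w k))) Y = 0" if "k < r" for k
      using q[rule_format, of "2 * k"] that by (simp add: fipY c_def dot_def mult.commute)
    have c2: "frob D (S * of_coords (w k)) Y = 0" if "k < r" for k
      using q[rule_format, of "2 * k + 1"] that by (simp add: fipY c_def dot_def mult.commute)
    \<comment> \<open>The functionals test the basis \<open>w\<close> only; by linearity they vanish on the whole ideal.\<close>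
    have by_span: "frob D (of_coords d) X = 0"
      if "top_singular N (regular S) C d" "\<And>k. k < r \<Longrightarrow> frob D (of_coords (w k)) X = 0" for d X
    proof -
      have sp: "\<forall>j\<in>{..<N}. d j = (\<Sum>k<r. dot {..<N} (w k) d * w k j)"
        using span that(1) unfolding top_eq by blast
      have fe: "frob D (of_coords e) X = dot {..<N} e (\<lambda>j. frob D X (f j))" for e
        unfolding frob_commute[of D "of_coords e"] frob_of_coords_right dot_def ..
      have "frob D (of_coords d) X = dot {..<N} (\<lambda>j. \<Sum>k<r. dot {..<N} (w k) d * w k j) (\<lambda>j. frob D X (f j))"
        unfolding fe using sp by (intro dot_cong) auto
      also have "\<dots> = (\<Sum>k<r. dot {..<N} (w k) d * frob D (of_coords (w k)) X)"
        by (simp add: dot_sum_left dot_scale_left fe)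
      finally show ?thesis using that(2) by simp
    qed
    have ec: "of_coords d \<in> carrier_mat D D" for d by simp
    have adj: "frob D (mat_adjoint (of_coords d)) Y = frob D (of_coords d) (mat_adjoint Y)" for d
      using frob_adjoint[of "of_coords d" D "mat_adjoint Y"] Yc by simp
    have adj2: "frob D (S * of_coords d) Y = frob D (of_coords d) (mat_adjoint S * Y)" for d
      using Sc Yc by (simp add: frob_mult_left)
    have ann: "Y * of_coords (w i) = 0\<^sub>m D D" "mat_adjoint Y * (S * of_coords (w i)) = 0\<^sub>m D D"
    proof -
      have t: "top_singular N (regular S) C (w i)" using top[OF i] unfolding top_eq .
      have 1: "frob D (mat_adjoint (of_coords d)) Y = 0" if "top_singular N (regular S) C d" for d
        using by_span[OF that, of "mat_adjoint Y"] c1 unfolding adj by blast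
      have 2: "frob D (S * of_coords d) Y = 0" if "top_singular N (regular S) C d" for d
        using by_span[OF that, of "mat_adjoint S * Y"] c2 unfolding adj2 by blast
      show "Y * of_coords (w i) = 0\<^sub>m D D" "mat_adjoint Y * (S * of_coords (w i)) = 0\<^sub>m D D"
        using orthogonal_to_ideal_annihilates[OF S Y t 1 2] by auto
    qed
    have "mat_vec N (lin_comb L y ?T) (w i) a = frob D (f a) (Y * of_coords (w i))"
      unfolding mvc Y_def[symmetric] by (rule mat_vec_regular[OF Yc a])
    then have g1: "mat_vec N (lin_comb L y ?T) (w i) a = 0" by (simp add: ann)
    have cr: "lin_comb L y ?T b a = regular Y b a" for b
      unfolding Y_def by (rule lin_comb_regular[OF _ a]) (rule A)
    have "mat_vec N (transposed (lin_comb L y ?T)) (mat_vec N (lin_comb L z ?T) (w i)) a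
        = (\<Sum>b<N. frob D (f b) (S * of_coords (w i)) * frob D (Y * f a) (f b))"
      unfolding mvz mat_vec_def[of N "transposed (lin_comb L y ?T)"] unfolding transposed_def cr
      by (intro sum.cong refl) (simp add: mat_vec_regular[OF Sc], simp add: regular_def frob_commute[of D "Y * f a"])
    also have "\<dots> = frob D (Y * f a) (S * of_coords (w i))"
      using S by (intro frob_expand[symmetric] mult_mem) auto
    also have "\<dots> = frob D (f a) (mat_adjoint Y * (S * of_coords (w i)))"
      using Yc Sc fc[OF a] by (intro frob_mult_left) auto
    finally show "mat_vec N (lin_comb L y ?T) (w i) a = 0 \<and> mat_vec N (transposed (lin_comb L y ?T)) (mat_vec N (lin_comb L z ?T) (w i)) a = 0"
      using g1 by (simp add: ann)
  qed
qed

end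

lemma subalgebra_abelian_group:
  assumes "star_subalgebra D \<A>"
  shows "abelian_group ((op_space D)\<lparr>carrier := \<A>\<rparr>)"
  using vectorspace.axioms(1)[OF star_subalgebraD(7)[OF assms]] by (rule module.axioms(2))

lemma lincomb_entries:
  assumes star: "star_subalgebra D \<A>" and "finite B" "B \<subseteq> \<A>" "p < D" "q < D"
  shows "module.lincomb ((op_space D)\<lparr>carrier := \<A>\<rparr>) \<gamma> B $$ (p,q) = (\<Sum>b\<in>B. \<gamma> b * b $$ (p,q))"
proof -
  let ?V = "(op_space D)\<lparr>carrier := \<A>\<rparr>"
  interpret V: vectorspace class_ring ?V by (rule star_subalgebraD(7)[OF star])
  have "V.lincomb \<gamma> B $$ (p,q) = (\<Sum>b\<in>B. (\<gamma> b \<odot>\<^bsub>?V\<^esub> b) $$ (p,q))"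
    unfolding V.lincomb_def
  proof (rule finsum_entries[OF subalgebra_abelian_group[OF star]])
    show "\<gamma> b \<odot>\<^bsub>?V\<^esub> b \<in> carrier ?V" if "b \<in> B" for b
      using star_subalgebraD(3)[OF star, of b "\<gamma> b"] assms(3) that by (auto simp: module_mat_simps)
  qed (use assms star_subalgebraD(1)[OF star] in \<open>auto simp: module_mat_simps\<close>)
  also have "\<dots> = (\<Sum>b\<in>B. \<gamma> b * b $$ (p,q))"
  proof (rule sum.cong[OF refl])
    fix b assume "b \<in> B"
    then have "b \<in> carrier_mat D D" using assms(3) star_subalgebraD(1)[OF star] by auto
    then show "(\<gamma> b \<odot>\<^bsub>?V\<^esub> b) $$ (p,q) = \<gamma> b * b $$ (p,q)"
      using assms(4,5) by (auto simp: module_mat_simps)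
  qed
  finally show ?thesis .
qed

lemma matrix_algebra_exists:
  assumes star: "star_subalgebra D \<A>"
  shows "\<exists>N f. matrix_algebra D \<A> N f"
proof -
  note cl = star_subalgebraD[OF star]
  let ?P = "\<lambda>u. mat_of D u \<in> \<A>"
  obtain w N where w: "orthonormal (entry_coords D) w N" "\<And>i. i < N \<Longrightarrow> ?P (w i)"
    "\<And>u. ?P u \<Longrightarrow> \<forall>p\<in>entry_coords D. u p = (\<Sum>i<N. dot (entry_coords D) (w i) u * w i p)"
  proof (rule maximal_orthonormal[of "entry_coords D" ?P])
    show "?P (\<lambda>j. c * u j)" if "?P u" for u c using cl(3) that by (simp add: mat_of_scale)
    show "?P (\<lambda>j. u j - v j)" if "?P u" "?P v" for u v using cl(2,3) that by (simp add: mat_of_diff)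
    show "?P (\<lambda>j. 0)" using cl(4) by (simp add: mat_of_0)
  qed auto
  have "matrix_algebra D \<A> N (\<lambda>i. mat_of D (w i))"
  proof
    show "star_subalgebra D \<A>" by fact
    show "mat_of D (w i) \<in> \<A>" if "i < N" for i using w(2)[OF that] .
    show "frob D (mat_of D (w i)) (mat_of D (w j)) = (if i = j then 1 else 0)" if "i < N" "j < N" for i j
      using w(1) that by (simp add: orthonormal_def dot_mat_of)
    fix a assume a: "a \<in> \<A>"
    have ac: "a \<in> carrier_mat D D" using a cl(1) by auto
    have e: "\<forall>p\<in>entry_coords D. vec_of a p = (\<Sum>i<N. frob D (mat_of D (w i)) a * w i p)"
      using w(3)[of "vec_of a"] a ac by (simp add: mat_of_vec_of dot_mat_of)
    show "mat_comb D {..<N} (\<lambda>i. frob D (mat_of D (w i)) a) (\<lambda>i. mat_of D (w i)) = a"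
    proof (rule eq_matI)
      fix p q assume "p < dim_row a" "q < dim_col a"
      then have pq: "p < D" "q < D" using ac by auto
      have "a $$ (p,q) = mat_of D (vec_of a) $$ (p,q)" using ac by (simp add: mat_of_vec_of)
      also have "\<dots> = mat_of D (\<lambda>x. \<Sum>i<N. frob D (mat_of D (w i)) a * w i x) $$ (p,q)"
        using e pq by (simp add: mat_of_def entry_coords_def)
      also have "\<dots> = (\<Sum>i<N. complex_of_real (frob D (mat_of D (w i)) a) * mat_of D (w i) $$ (p,q))"
        using pq by (rule mat_of_index_sum)
      finally show "mat_comb D {..<N} (\<lambda>i. frob D (mat_of D (w i)) a) (\<lambda>i. mat_of D (w i)) $$ (p,q) = a $$ (p,q)"
        using pq by (simp add: mat_comb_def)
    qed (use ac in \<open>auto simp: mat_comb_def\<close>)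
  qed
  then show ?thesis by blast
qed

context matrix_algebra
begin

lemma basis_inj: "inj_on f {..<N}"
proof (rule inj_onI)
  fix i j assume "i \<in> {..<N}" "j \<in> {..<N}" "f i = f j"
  then show "i = j" using f_on[of i j] f_on[of i i] by (auto split: if_splits)
qed

text \<open>
  A minimal complex generating set \<open>B\<close> expresses each \<open>f i\<close> by \<open>2 card B\<close> real numbers. If \<open>N\<close> were larger,
  a nontrivial real combination of the \<open>f i\<close> would have all these numbers zero, contradicting
  orthonormality. That a finite generating set exists at all, so that the minimum is attained, is
  witnessed by \<open>f\<close>.
\<close>

lemma real_dimension_le_twice_complex: "N \<le> 2 * complex_dim D \<A>"
proof -
  let ?V = "(op_space D)\<lparr>carrier := \<A>\<rparr>"
  interpret V: vectorspace class_ring ?V by (rule star_subalgebraD(7)[OF star])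
  let ?gen = "\<lambda>n. \<exists>B. finite B \<and> card B = n \<and> B \<subseteq> carrier ?V \<and> V.span B = carrier ?V"
  have "?gen N"
  proof (intro exI conjI)
    let ?B = "f ` {..<N}"
    show fin: "finite ?B" by simp
    show "card ?B = N" using basis_inj by (simp add: card_image)
    show sub: "?B \<subseteq> carrier ?V" using f_mem by auto
    have "a \<in> V.span ?B" if a: "a \<in> \<A>" for a
    proof -
      let ?g = "\<lambda>b. complex_of_real (frob D b a)"
      have "V.lincomb ?g ?B \<in> \<A>"
        using V.lincomb_closed[of ?B ?g] sub by (auto simp: class_ring_simps)
      then have car: "V.lincomb ?g ?B \<in> carrier_mat D D" "a \<in> carrier_mat D D"
        using a carrierD by auto
      have "V.lincomb ?g ?B = a"
      proof (rule eq_matI)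
        fix p q assume "p < dim_row a" "q < dim_col a"
        then have pq: "p < D" "q < D" using car by auto
        have "V.lincomb ?g ?B $$ (p,q) = (\<Sum>b\<in>?B. ?g b * b $$ (p,q))"
          using sub pq by (intro lincomb_entries[OF star]) auto
        also have "\<dots> = (\<Sum>i<N. ?g (f i) * f i $$ (p,q))"
          using basis_inj by (simp add: sum.reindex)
        also have "\<dots> = mat_comb D {..<N} (\<lambda>i. frob D (f i) a) f $$ (p,q)"
          using pq by (simp add: mat_comb_def)
        finally show "V.lincomb ?g ?B $$ (p,q) = a $$ (p,q)" by (simp only: f_span[OF a])
      qed (use car in auto)
      then show ?thesis
        unfolding V.finite_span[OF fin sub] by (intro CollectI exI[of _ ?g]) (auto simp: class_ring_simps)
    qed
    moreover have "V.span ?B \<subseteq> carrier ?V" using V.span_is_subset2[OF sub] .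
    ultimately show "V.span ?B = carrier ?V" by auto
  qed
  then have "?gen (complex_dim D \<A>)"
    unfolding complex_dim_def V.dim_def by (rule LeastI)
  then obtain B where B: "finite B" "card B = complex_dim D \<A>" "B \<subseteq> \<A>" "V.span B = \<A>"
    by auto
  have "\<exists>g. \<forall>p<D. \<forall>q<D. f i $$ (p,q) = (\<Sum>b\<in>B. g b * b $$ (p,q))" if i: "i < N" for i
  proof -
    have "f i \<in> V.span B" using f_mem[OF i] B(4) by simp
    then obtain g where "f i = V.lincomb g B"
      using V.finite_span[OF B(1)] B(3) by auto
    then show ?thesis using lincomb_entries[OF star B(1,3), of _ _ g] by auto
  qed
  then obtain g where g: "\<And>i p q. i < N \<Longrightarrow> p < D \<Longrightarrow> q < D \<Longrightarrow> f i $$ (p,q) = (\<Sum>b\<in>B. g i b * b $$ (p,q))"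
    by metis
  show ?thesis
  proof (rule ccontr)
    assume "\<not> N \<le> 2 * complex_dim D \<A>"
    then have "card (B \<times> (UNIV :: bool set)) < card {..<N}"
      using B(2) by (simp add: card_cartesian_product)
    then obtain y where y: "\<exists>i\<in>{..<N}. y i \<noteq> 0"
      "\<forall>x\<in>B \<times> UNIV. dot {..<N} (\<lambda>i. if snd x then Re (g i (fst x)) else Im (g i (fst x))) y = 0"
      using homogeneous_system_solvable[of "B \<times> (UNIV :: bool set)" "{..<N}"
          "\<lambda>x i. if snd x then Re (g i (fst x)) else Im (g i (fst x))"] B(1) by auto
    have g0: "(\<Sum>i<N. complex_of_real (y i) * g i b) = 0" if "b \<in> B" for b
      using y(2)[rule_format, of "(b, True)"] y(2)[rule_format, of "(b, False)"] that
      by (simp add: dot_def complex_eq_iff mult.commute)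
    have "of_coords y = 0\<^sub>m D D"
    proof (rule eq_matI)
      fix p q assume "p < dim_row (0\<^sub>m D D :: complex mat)" "q < dim_col (0\<^sub>m D D :: complex mat)"
      then have pq: "p < D" "q < D" by auto
      have "of_coords y $$ (p,q) = (\<Sum>i<N. \<Sum>b\<in>B. complex_of_real (y i) * g i b * b $$ (p,q))"
        using pq by (simp add: mat_comb_def g sum_distrib_left mult.assoc)
      also have "\<dots> = (\<Sum>b\<in>B. (\<Sum>i<N. complex_of_real (y i) * g i b) * b $$ (p,q))"
        unfolding sum_distrib_right by (rule sum.swap)
      finally show "of_coords y $$ (p,q) = 0\<^sub>m D D $$ (p,q)" using g0 pq by simp
    qed (auto simp: mat_comb_def)
    then have "y i = 0" if "i < N" for i
      using frob_basis_of_coords[OF that, of y] by simp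
    then show False using y(1) by auto
  qed
qed

end

section \<open>The operator norm as the norm of left multiplication\<close>

text \<open>
  The ratios \<open>b (Suc j) / b j\<close> increase with \<open>j\<close>, so a first ratio above \<open>q\<close> would force growth faster than
  \<open>q\<^sup>j\<close>.
\<close>

lemma log_convex_first_ratio:
  fixes b :: "nat \<Rightarrow> real"
  assumes nn: "\<And>j. 0 \<le> b j" and lc: "\<And>j. (b (Suc j))\<^sup>2 \<le> b j * b (Suc (Suc j))"
    and bd: "\<And>j. b (Suc j) \<le> M * q ^ j" and "0 \<le> q"
  shows "b 1 \<le> q * b 0"
proof (rule ccontr)
  assume neg: "\<not> b 1 \<le> q * b 0"
  have b0: "b 0 > 0"
  proof (rule ccontr)
    assume "\<not> b 0 > 0"
    then have "b 0 = 0" using nn[of 0] by simp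
    then have "b 1 = 0" using lc[of 0] by simp
    then show False using neg \<open>b 0 = 0\<close> by simp
  qed
  define \<rho> where "\<rho> = b 1 / b 0"
  have \<rho>: "\<rho> > q" using neg b0 by (simp add: \<rho>_def field_simps)
  have \<rho>0: "\<rho> > 0" using \<rho> \<open>0 \<le> q\<close> by simp
  have step: "b j > 0 \<and> b (Suc j) \<ge> \<rho> * b j" for j
  proof (induction j)
    case 0 then show ?case using b0 by (simp add: \<rho>_def)
  next
    case (Suc j)
    then have pos: "b (Suc j) > 0" using \<rho>0 by (meson less_le_trans mult_pos_pos)
    have "b j * (\<rho> * b (Suc j)) \<le> b (Suc j) * b (Suc j)"
      using Suc pos mult_right_mono[of "\<rho> * b j" "b (Suc j)" "b (Suc j)"] by (simp add: mult_ac)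
    also have "\<dots> \<le> b j * b (Suc (Suc j))" using lc[of j] by (simp add: power2_eq_square)
    finally show ?case using Suc pos by (simp add: mult_le_cancel_left)
  qed
  have grow: "b (Suc j) \<ge> \<rho> ^ j * b 1" for j
  proof (induction j)
    case (Suc j)
    have "\<rho> ^ Suc j * b 1 = \<rho> * (\<rho> ^ j * b 1)" by simp
    also have "\<dots> \<le> \<rho> * b (Suc j)" using Suc \<rho>0 by (intro mult_left_mono) auto
    also have "\<dots> \<le> b (Suc (Suc j))" using step by blast
    finally show ?case .
  qed simp
  have b1: "b 1 > 0" using step[of 1] by simp
  show False
  proof (cases "q = 0")
    case True
    have "\<rho> * b 1 \<le> M * 0" using grow[of 1] bd[of 1] True by simp
    then show False using \<rho>0 b1 by (simp add: mult_le_0_iff)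
  next
    case False
    then have q: "q > 0" using \<open>0 \<le> q\<close> by simp
    then obtain j where j: "(\<rho> / q) ^ j > M / b 1"
      using real_arch_pow[of "\<rho> / q" "M / b 1"] \<rho> by auto
    have "\<rho> ^ j * b 1 \<le> M * q ^ j" using grow[of j] bd[of j] by simp
    then have "(\<rho> / q) ^ j \<le> M / b 1" using q b1 by (simp add: power_divide field_simps)
    then show False using j by simp
  qed
qed

context matrix_algebra
begin

text \<open>
  Faithfulness of the regular representation, without spectral theory. Put \<open>h = a\<^sup>* a\<close>. For \<open>j \<ge> 1\<close> the
  power \<open>h\<^sup>j\<close> lies in the algebra, so \<open>\<parallel>h\<^sup>j\<parallel>\<close> grows at most like \<open>K\<^sup>2\<^sup>j\<close>, and hence so does \<open>\<parallel>h\<^sup>j V\<parallel>\<close> for an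
  arbitrary matrix \<open>V\<close>. Since \<open>h\<close> is self-adjoint, \<open>\<parallel>h\<^sup>j V\<parallel>\<close> is log-convex in \<open>j\<close>, which turns the growth
  rate into the bound \<open>\<parallel>h V\<parallel> \<le> K\<^sup>2 \<parallel>V\<parallel>\<close>.
\<close>

lemma bound_extends_from_algebra:
  assumes a: "a \<in> \<A>" and K: "0 \<le> K"
    and bd: "\<And>W. W \<in> \<A> \<Longrightarrow> frob D (a * W) (a * W) \<le> K\<^sup>2 * frob D W W"
    and V: "V \<in> carrier_mat D D"
  shows "frob D (a * V) (a * V) \<le> K\<^sup>2 * frob D V V"
proof -
  define h where "h = mat_adjoint a * a"
  have h: "h \<in> \<A>" unfolding h_def using a by (intro mult_mem adjoint_mem)
  note car = carrierD[OF a] carrierD[OF h] V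
  have hbd: "frob D (h * W) (h * W) \<le> K^4 * frob D W W" if W: "W \<in> \<A>" for W
  proof -
    let ?p = "frob D (h * W) (h * W)"
    have hW: "h * W \<in> \<A>" "a * W \<in> \<A>" using h a W by (auto intro: mult_mem)
    note car' = carrierD[OF hW(1)] carrierD[OF hW(2)] carrierD[OF W]
    have "h * W = mat_adjoint a * (a * W)"
      unfolding h_def using car car' by (simp add: assoc_mult_mat[of _ D D _ D _ D])
    then have "?p = frob D (a * W) (a * (h * W))"
      using car car' frob_mult_left[of "mat_adjoint a" D "a * W" "h * W"] by simp
    then have "?p\<^sup>2 \<le> frob D (a * W) (a * W) * frob D (a * (h * W)) (a * (h * W))"
      using frob_Cauchy_Schwarz by metis
    also have "\<dots> \<le> (K\<^sup>2 * frob D W W) * (K\<^sup>2 * ?p)"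
      using bd[OF W] bd[OF hW(1)] by (intro mult_mono) (auto simp: frob_nonneg)
    finally have "?p * ?p \<le> (K^4 * frob D W W) * ?p"
      by (simp add: power2_eq_square power4_eq_xxxx mult_ac)
    then show ?thesis
      using frob_nonneg[of D "h * W"] frob_nonneg[of D W]
      by (cases "?p = 0") (auto simp: mult_le_cancel_right)
  qed
  \<comment> \<open>\<open>H j = h ^ (j + 1)\<close>; the power zero may lie outside the algebra, which need not be unital.\<close>
  define H where "H = rec_nat h (\<lambda>_ x. h * x)"
  have H: "H 0 = h" "\<And>j. H (Suc j) = h * H j" by (simp_all add: H_def)
  have H_mem: "H j \<in> \<A>" for j by (induction j) (auto simp: H h mult_mem)
  have H_bd: "frob D (H j) (H j) \<le> frob D h h * (K^4)^j" for j
  proof (induction j)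
    case (Suc j)
    have "frob D (H (Suc j)) (H (Suc j)) \<le> K^4 * frob D (H j) (H j)" unfolding H(2) by (rule hbd[OF H_mem])
    also have "\<dots> \<le> K^4 * (frob D h h * (K^4)^j)" using Suc by (intro mult_left_mono) auto
    finally show ?case by (simp add: mult_ac)
  qed (simp add: H)
  define X where "X = (\<lambda>j. case j of 0 \<Rightarrow> V | Suc k \<Rightarrow> H k * V)"
  have X_car: "X j \<in> carrier_mat D D" for j
    using V carrierD[OF H_mem] by (auto simp: X_def split: nat.split intro!: mult_carrier_mat[of _ D D])
  have X_Suc: "X (Suc j) = h * X j" for j
    using car carrierD[OF H_mem] by (auto simp: X_def H assoc_mult_mat[of _ D D _ D _ D] split: nat.split)
  have h_sym: "mat_adjoint h = h" unfolding h_def using car by (simp add: mat_adjoint_mult[of _ D])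
  define b where "b = (\<lambda>j. frob D (X j) (X j))"
  have "b 1 \<le> K^4 * b 0"
  proof (rule log_convex_first_ratio)
    show "0 \<le> b j" for j by (simp add: b_def frob_nonneg)
    show "(b (Suc j))\<^sup>2 \<le> b j * b (Suc (Suc j))" for j
    proof -
      have "b (Suc j) = frob D (X j) (X (Suc (Suc j)))"
        unfolding b_def using frob_mult_left[OF car(2) X_car X_car, of j "Suc j"] by (simp add: X_Suc h_sym)
      then show ?thesis unfolding b_def using frob_Cauchy_Schwarz by metis
    qed
    show "b (Suc j) \<le> (frob D h h * frob D V V) * (K^4)^j" for j
    proof -
      have "b (Suc j) \<le> frob D (H j) (H j) * frob D V V"
        unfolding b_def X_def using frob_submultiplicative[OF carrierD[OF H_mem] V] by simp
      also have "\<dots> \<le> (frob D h h * (K^4)^j) * frob D V V"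
        using H_bd by (intro mult_right_mono) (auto simp: frob_nonneg)
      finally show ?thesis by (simp add: mult_ac)
    qed
  qed (use K in simp)
  then have hV: "frob D (h * V) (h * V) \<le> K^4 * frob D V V"
    by (simp add: b_def X_Suc) (simp add: X_def)
  have "frob D (a * V) (a * V) = frob D V (h * V)"
    using car frob_mult_left[of a D V "a * V"] by (simp add: h_def assoc_mult_mat[of _ D D _ D _ D])
  then have "(frob D (a * V) (a * V))\<^sup>2 \<le> frob D V V * frob D (h * V) (h * V)"
    using frob_Cauchy_Schwarz by metis
  also have "\<dots> \<le> frob D V V * (K^4 * frob D V V)"
    using hV by (intro mult_left_mono) (auto simp: frob_nonneg)
  also have "\<dots> = (K\<^sup>2 * frob D V V)\<^sup>2" by (simp add: power2_eq_square power4_eq_xxxx)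
  finally show ?thesis by (rule power2_le_imp_le) (simp add: frob_nonneg)
qed

end

lemma hnorm_power2: "(hnorm v)\<^sup>2 = (\<Sum>i<dim_vec v. (cmod (v $ i))\<^sup>2)"
  by (simp add: hnorm_L2_set L2_set_def sum_nonneg)

lemma frob_columns:
  assumes "a \<in> carrier_mat D D"
  shows "frob D a a = (\<Sum>j<D. (hnorm (col a j))\<^sup>2)"
proof -
  have "frob D a a = (\<Sum>j<D. \<Sum>i<D. (cmod (a $$ (i,j)))\<^sup>2)"
    unfolding frob_self by (rule sum.swap)
  also have "\<dots> = (\<Sum>j<D. (hnorm (col a j))\<^sup>2)"
    by (intro sum.cong refl) (use assms in \<open>simp add: hnorm_power2\<close>)
  finally show ?thesis .
qed

lemma hnorm_smult: "hnorm (c \<cdot>\<^sub>v v) = cmod c * hnorm v"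
proof -
  have "L2_set (\<lambda>i. cmod ((c \<cdot>\<^sub>v v) $ i)) {..<dim_vec v} = L2_set (\<lambda>i. cmod c * cmod (v $ i)) {..<dim_vec v}"
    by (rule L2_set_cong) (auto simp: norm_mult)
  then show ?thesis by (simp add: hnorm_L2_set L2_set_right_distrib)
qed

lemma hnorm_mult_le:
  assumes "a \<in> carrier_mat D D" "v \<in> carrier_vec D"
  shows "hnorm (a *\<^sub>v v) \<le> op_norm a * hnorm v"
proof (cases "hnorm v = 0")
  case True
  then have v: "\<forall>i<D. v $ i = 0"
    using assms(2) by (simp add: hnorm_L2_set L2_set_eq_0_iff)
  have "v = 0\<^sub>v D" using v assms(2) by (intro eq_vecI) auto
  then have "a *\<^sub>v v = 0\<^sub>v D" using assms(1) by auto
  then show ?thesis using True by (simp add: hnorm_def)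
next
  case False
  have "hnorm v \<ge> 0" by (simp add: hnorm_L2_set)
  then have pos: "hnorm v > 0" using False by simp
  let ?c = "complex_of_real (1 / hnorm v)"
  have "hnorm (a *\<^sub>v (?c \<cdot>\<^sub>v v)) \<le> op_norm a"
    unfolding op_norm_def
    by (rule cSUP_upper[OF _ op_norm_bdd_above]) (use assms pos in \<open>auto simp: hnorm_smult norm_divide\<close>)
  moreover have "a *\<^sub>v (?c \<cdot>\<^sub>v v) = ?c \<cdot>\<^sub>v (a *\<^sub>v v)"
    using assms by (rule mult_mat_vec)
  ultimately show ?thesis using pos by (simp add: hnorm_smult norm_divide field_simps)
qed

lemma frob_le_of_op_norm_le_1:
  assumes "a \<in> carrier_mat D D" "W \<in> carrier_mat D D" "op_norm a \<le> 1"
  shows "frob D (a * W) (a * W) \<le> frob D W W"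
proof -
  have col_le: "(hnorm (col (a * W) j))\<^sup>2 \<le> (hnorm (col W j))\<^sup>2" if "j < D" for j
  proof (rule power_mono)
    have c: "col W j \<in> carrier_vec D" using assms(2) by (intro carrier_vecI) auto
    have h0: "0 \<le> hnorm (col W j)" by (simp add: hnorm_L2_set)
    have "col (a * W) j = a *\<^sub>v col W j" using assms that by (intro col_mult2) auto
    then have "hnorm (col (a * W) j) \<le> op_norm a * hnorm (col W j)"
      using hnorm_mult_le[OF assms(1) c] by simp
    also have "\<dots> \<le> 1 * hnorm (col W j)" using assms(3) h0 by (rule mult_right_mono)
    finally show "hnorm (col (a * W) j) \<le> hnorm (col W j)" by simp
  qed (simp add: hnorm_L2_set)
  show ?thesis
    unfolding frob_columns[OF mult_carrier_mat[OF assms(1,2)]] frob_columns[OF assms(2)]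
    by (rule sum_mono, rule col_le) simp
qed

text \<open>
  Apply the hypothesis to the matrix all of whose \<open>D\<close> columns are \<open>v\<close>; both sides scale by \<open>D\<close>.
\<close>

lemma op_norm_le_of_frob_le:
  assumes a: "a \<in> carrier_mat D D" and K: "0 \<le> K"
    and bd: "\<And>V. V \<in> carrier_mat D D \<Longrightarrow> frob D (a * V) (a * V) \<le> K\<^sup>2 * frob D V V"
  shows "op_norm a \<le> K"
  unfolding op_norm_def
proof (rule cSUP_least)
  have "0\<^sub>v (dim_col a) \<in> {v \<in> carrier_vec (dim_col a). hnorm v \<le> 1}" by (simp add: hnorm_def)
  then show "{v \<in> carrier_vec (dim_col a). hnorm v \<le> 1} \<noteq> {}" by blast
next
  fix v assume "v \<in> {v \<in> carrier_vec (dim_col a). hnorm v \<le> 1}"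
  then have v: "v \<in> carrier_vec D" "hnorm v \<le> 1" using a by auto
  show "hnorm (a *\<^sub>v v) \<le> K"
  proof (cases "D = 0")
    case True
    then show ?thesis using a K by (simp add: hnorm_L2_set)
  next
    case False
    define V where "V = mat D D (\<lambda>(i,j). v $ i)"
    have V: "V \<in> carrier_mat D D" by (simp add: V_def)
    have colV: "col V j = v" if "j < D" for j using that v(1) by (intro eq_vecI) (auto simp: V_def)
    have "col (a * V) j = a *\<^sub>v v" if "j < D" for j by (simp only: col_mult2[OF a V that] colV[OF that])
    then have "real D * (hnorm (a *\<^sub>v v))\<^sup>2 \<le> K\<^sup>2 * (real D * (hnorm v)\<^sup>2)"
      using bd[OF V] a V colV by (simp add: frob_columns[of _ D])
    then have "real D * (hnorm (a *\<^sub>v v))\<^sup>2 \<le> real D * (K * hnorm v)\<^sup>2"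
      by (simp add: power_mult_distrib mult_ac)
    then have "(hnorm (a *\<^sub>v v))\<^sup>2 \<le> (K * hnorm v)\<^sup>2" using False by (simp add: mult_le_cancel_left)
    then have "hnorm (a *\<^sub>v v) \<le> K * hnorm v"
      by (rule power2_le_imp_le) (simp add: K hnorm_L2_set)
    also have "\<dots> \<le> K * 1" using v(2) K by (rule mult_left_mono)
    finally show ?thesis by simp
  qed
qed

lemma signed_finsum_eq_msum:
  assumes "finite L" "\<And>l. l \<in> L \<Longrightarrow> A l \<in> carrier_mat D D"
  shows "(\<Oplus>\<^bsub>op_space D\<^esub>l\<in>L. complex_of_real (x l) \<cdot>\<^sub>m A l) = mat_comb D L x A"
proof -
  have ab: "abelian_group (op_space D)" by (rule abelian_group_mat)
  interpret abelian_group "op_space D" by (rule ab)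
  have mem: "complex_of_real (x l) \<cdot>\<^sub>m A l \<in> carrier (op_space D)" if "l \<in> L" for l
    using assms(2)[OF that] by (simp add: module_mat_simps)
  have "(\<Oplus>\<^bsub>op_space D\<^esub>l\<in>L. complex_of_real (x l) \<cdot>\<^sub>m A l) \<in> carrier (op_space D)"
    using mem by (intro finsum_closed) auto
  then have car: "(\<Oplus>\<^bsub>op_space D\<^esub>l\<in>L. complex_of_real (x l) \<cdot>\<^sub>m A l) \<in> carrier_mat D D"
    by (simp add: module_mat_simps)
  show ?thesis
  proof (rule eq_matI)
    fix p q assume "p < dim_row (mat_comb D L x A)" "q < dim_col (mat_comb D L x A)"
    then have pq: "p < D" "q < D" by (auto simp: mat_comb_def)
    have "(\<Oplus>\<^bsub>op_space D\<^esub>l\<in>L. complex_of_real (x l) \<cdot>\<^sub>m A l) $$ (p,q)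
        = (\<Sum>l\<in>L. (complex_of_real (x l) \<cdot>\<^sub>m A l) $$ (p,q))"
      by (rule finsum_entries[OF ab _ _ _ assms(1) mem pq]) (auto simp: module_mat_simps)
    also have "\<dots> = (\<Sum>l\<in>L. complex_of_real (x l) * A l $$ (p,q))"
      by (rule sum.cong[OF refl], subst index_smult_mat) (use assms(2) pq in auto)
    also have "\<dots> = mat_comb D L x A $$ (p,q)" using pq by (simp add: mat_comb_def)
    finally show "(\<Oplus>\<^bsub>op_space D\<^esub>l\<in>L. complex_of_real (x l) \<cdot>\<^sub>m A l) $$ (p,q) = mat_comb D L x A $$ (p,q)" .
  qed (use car in \<open>auto simp: mat_comb_def\<close>)
qed

theorem theorem1p3:
  shows "\<forall>C0::real. C0 > 0 \<longrightarrow>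
    (\<exists>C::real. C > 0 \<and>
      (\<forall>(n::nat) (d::nat) (\<A> :: complex mat set) (A :: nat \<Rightarrow> complex mat).
         n \<ge> 1 \<longrightarrow>
         star_subalgebra d \<A> \<longrightarrow>
         real (complex_dim d \<A>) \<le> C0 * real n \<longrightarrow>
         (\<forall>i\<in>{1..n}. A i \<in> \<A> \<and> op_norm (A i) \<le> 1) \<longrightarrow>
         (\<exists>x :: nat \<Rightarrow> real.
            (\<forall>i\<in>{1..n}. x i \<in> {-1, 1}) \<and>
            op_norm (\<Oplus>\<^bsub>op_space d\<^esub>i\<in>{1..n}. complex_of_real (x i) \<cdot>\<^sub>m A i)
              \<le> C * sqrt (real n))))"
proof (intro allI impI, rule exI, intro conjI allI impI)
  fix C0 :: real assume C0: "C0 > 0"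
  show "56 * root 4 (2 * C0) > 0" using C0 by simp
  fix n d and \<A> :: "complex mat set" and A :: "nat \<Rightarrow> complex mat"
  assume n: "n \<ge> 1" and star: "star_subalgebra d \<A>"
    and dim: "real (complex_dim d \<A>) \<le> C0 * real n"
    and A: "\<forall>i\<in>{1..n}. A i \<in> \<A> \<and> op_norm (A i) \<le> 1"
  obtain N f where "matrix_algebra d \<A> N f" using matrix_algebra_exists[OF star] by blast
  then interpret matrix_algebra d \<A> N f .
  let ?L = "{1..n}" and ?T = "\<lambda>l. regular (A l)"
  interpret contraction_family N ?L ?T
  proof (rule regular_contraction_family)
    show "frob d (A l * W) (A l * W) \<le> frob d W W" if "l \<in> ?L" "W \<in> \<A>" for l W
      using A that by (intro frob_le_of_op_norm_le_1) (auto intro: carrierD)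
  qed (use A in auto)
  define R where "R = 2 * C0 * real n"
  have R: "R > 0" "real N \<le> R" using C0 n dim real_dimension_le_twice_complex by (auto simp: R_def)
  obtain x where x: "\<forall>l\<in>?L. x l \<in> {-1, 1}"
      "op_bound N (lin_comb ?L (\<lambda>l. x l - 0) ?T) (56 * root 4 (R * real (card ?L)))"
    using full_coloring[of ?L R "\<lambda>_. 0"] R by auto
  define K where "K = 56 * root 4 (R * real n)"
  have K0: "0 \<le> K" using R by (simp add: K_def)
  define S where "S = mat_comb d ?L x A"
  have S: "S \<in> \<A>" unfolding S_def using A by (intro mat_comb_mem[OF star]) auto
  have "op_bound N (regular S) K"
    using x(2) mat_vec_lin_comb_regular[of ?L A x] A unfolding op_bound_def S_def K_def by simp
  then have bd: "frob d (S * W) (S * W) \<le> K\<^sup>2 * frob d W W" if "W \<in> \<A>" for W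
    using that unfolding op_bound_regular_iff[OF S] by blast
  have "op_norm S \<le> K"
    by (rule op_norm_le_of_frob_le[OF carrierD[OF S] K0]) (rule bound_extends_from_algebra[OF S K0 bd])
  also have "K = 56 * root 4 (2 * C0) * sqrt (real n)"
  proof -
    have "root 4 (real n * real n) = sqrt (real n)"
      using n by (intro real_root_pos_unique) (auto simp: power4_eq_xxxx mult.assoc)
    then show ?thesis by (simp add: K_def R_def mult.assoc real_root_mult)
  qed
  also have "S = (\<Oplus>\<^bsub>op_space d\<^esub>i\<in>{1..n}. complex_of_real (x i) \<cdot>\<^sub>m A i)"
    unfolding S_def using A carrierD by (intro signed_finsum_eq_msum[symmetric]) auto
  finally show "\<exists>x :: nat \<Rightarrow> real. (\<forall>i\<in>{1..n}. x i \<in> {-1, 1}) \<and>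
      op_norm (\<Oplus>\<^bsub>op_space d\<^esub>i\<in>{1..n}. complex_of_real (x i) \<cdot>\<^sub>m A i)
        \<le> 56 * root 4 (2 * C0) * sqrt (real n)"
    using x(1) by blast
qed

end
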